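(* Let $\boldsymbol{\delta}=(1,2,1,2,1,2,3)$ and consider the vectors in $\mathbb{Z}^7$ $v_1=(0,1,0,0,0,0,0)$, $v_2=(1,1,0,0,0,0,1)$, $v_3=(1,1,0,1,0,1,1)$, $v_4=(0,1,1,1,1,1,2)$, $v_5=(0,1,1,2,1,2,2)$, $v_6=(1,1,1,2,1,2,3)$. For $k\ge1$ put $d_k=v_r+q\boldsymbol{\delta}$, where $k=6q+r$ with $q\ge 0$ and $1\le r\le 6$. Let $$D_2=\begin{pmatrix} 0&0&1&-1&1&-1&1\\ 0&0&0&-1&0&0&1\\ 1&-1&0&-1&1&-1&2\\ 0&0&0&0&0&-1&1\\ 1&-1&1&-1&0&-1&2\\ 2&-1&1&-2&1&-2&3\\ 1&-1&1&-2&1&-2&3\end{pmatrix}$$ and for $k\ge 6$ define $$D_k=\begin{cases} D_2\, c^{\,3-s} M_f, & k=2s,\\ D_2\, c^{\,3-s}\,\overset{\bullet}{c}\, M_f, & k=2s+1.\end{cases}$$ Let $\chi=(\alpha_1,\alpha_2,\beta_1,\beta_2,\delta_1,\delta_2,\gamma)$ be a real vector with $\alpha_1>\alpha_2>0$, $\beta_1>\beta_2>0$, $\delta_1>\delta_2>0$. Then for every $k\ge 8$ the $*$-algebra $\mathcal{A}_{\widetilde{E}_6,\chi}$ has an irreducible non-degenerate $*$-representation of generalized dimension $M_d d_k$ if and only if the first six coordinates of the vector $D_k\chi$ are strictly positive and its seventh coordinate equals $0$.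
   Context: The $*$-algebra $\mathcal{A}_{\widetilde{E}_6,\chi}$ is the unital complex $*$-algebra generated by self-adjoint idempotents $p_1,p_2,q_1,q_2,s_1,s_2$ with relations $p_1p_2=p_2p_1=0$, $q_1q_2=q_2q_1=0$, $s_1s_2=s_2s_1=0$ and $$\alpha_1p_1+\alpha_2p_2+\beta_1q_1+\beta_2q_2+\delta_1s_1+\delta_2s_2=\gamma e,$$ where $e$ is the identity. Equivalently, its $*$-representations are triples of Hermitian operators $A,B,D$ on a Hilbert space with spectra contained in $\{0,\alpha_1,\alpha_2\}$, $\{0,\beta_1,\beta_2\}$, $\{0,\delta_1,\delta_2\}$ and $A+B+D=\gamma I$. An irreducible finite-dimensional $*$-representation $\pi$ on a Hilbert space $H_0$ is called non-degenerate if $\pi(p_i),\pi(q_i),\pi(s_i)\ne 0$ for $i=1,2$ and $\pi(p_1)+\pi(p_2)\neq I$, $\pi(q_1)+\pi(q_2)\ne I$, $\pi(s_1)+\pi(s_2)\ne I$. Its generalized dimension is the vector $(\operatorname{rank}\pi(p_1),\operatorname{rank}\pi(p_2),\operatorname{rank}\pi(q_1),\operatorname{rank}\pi(q_2),\operatorname{rank}\pi(s_1),\operatorname{rank}\pi(s_2),\dim H_0)$. The graph $\widetilde{E}_6$ has central vertex $g_0$ and three branches $g_0-g_2-g_1$, $g_0-g_4-g_3$, $g_0-g_6-g_5$. Vectors indexed by its vertices are written $(x_1,x_2,x_3,x_4,x_5,x_6,x_0)$. The vertices $g_1,g_3,g_5,g_0$ are odd, and $g_2,g_4,g_6$ are even.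 The linear maps $\overset{\bullet}{c},\overset{\circ}{c}$ of $\mathbb{R}^7$ (both involutions) are $$\overset{\bullet}{c}(x)=(-x_1+x_2,\,x_2,\,-x_3+x_4,\,x_4,\,-x_5+x_6,\,x_6,\,-x_0+x_2+x_4+x_6),$$ $$\overset{\circ}{c}(x)=(x_1,\,-x_2+x_1+x_0,\,x_3,\,-x_4+x_3+x_0,\,x_5,\,-x_6+x_5+x_0,\,x_0),$$ and $c=\overset{\circ}{c}\,\overset{\bullet}{c}$ (first $\overset{\bullet}{c}$, then $\overset{\circ}{c}$), so $c^{-1}=\overset{\bullet}{c}\,\overset{\circ}{c}$. All matrices and maps act on column vectors. The transition matrices are given by $M_f\chi=(\alpha_1-\alpha_2,\,\alpha_1,\,\beta_1-\beta_2,\,\beta_1,\,\delta_1-\delta_2,\,\delta_1,\,\gamma)$ and $M_d(x_1,\dots,x_6,x_0)=(x_2-x_1,\,x_1,\,x_4-x_3,\,x_3,\,x_6-x_5,\,x_5,\,x_0)$. *)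

theory Defs
  imports
    "Jordan_Normal_Form.Schur_Decomposition"
    "Jordan_Normal_Form.DL_Rank"
    "HOL-Algebra.QuotRing"
    "HOL-Library.Poly_Mapping"
begin

section \<open>The star-algebra given by generators and relations\<close>

datatype gen = P1 | P2 | Q1 | Q2 | S1 | S2

text \<open>
  Finitely supported functions on words, with convolution as product, form the free unital
  complex algebra on the six generators. The wrapper type carries the concatenation monoid in
  additive notation, as the convolution product of \<^theory>\<open>HOL-Library.Poly_Mapping\<close> requires.
\<close>

datatype word = Word (letters: "gen list")

instantiation word :: monoid_add
begin

definition zero_word :: word where
  "0 = Word []"

definition plus_word :: "word \<Rightarrow> word \<Rightarrow> word" where
  "u + v = Word (letters u @ letters v)"

instance
  by standard (simp_all add: zero_word_def plus_word_def)

end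

type_synonym free_alg = "word \<Rightarrow>\<^sub>0 complex"

definition generator :: "gen \<Rightarrow> free_alg" where
  "generator g = Poly_Mapping.single (Word [g]) 1"

definition scalar :: "complex \<Rightarrow> free_alg" where
  "scalar a = Poly_Mapping.single 0 a"

text \<open>
  The conjugate-linear anti-multiplicative involution fixing the generators: it reverses words
  and conjugates coefficients.
\<close>

definition star :: "free_alg \<Rightarrow> free_alg" where
  "star x = Poly_Mapping.map_key (\<lambda>w. Word (rev (letters w))) (Poly_Mapping.map cnj x)"

text \<open>
  The parameter \<open>\<chi>\<close> is the vector
  \<open>(\<alpha>\<^sub>1, \<alpha>\<^sub>2, \<beta>\<^sub>1, \<beta>\<^sub>2, \<delta>\<^sub>1, \<delta>\<^sub>2, \<gamma>)\<close>, with indices starting at 0.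
\<close>

definition relators :: "real vec \<Rightarrow> free_alg set" where
  "relators \<chi> =
     {generator g * generator g - generator g | g. True} \<union>
     {generator P1 * generator P2, generator P2 * generator P1,
      generator Q1 * generator Q2, generator Q2 * generator Q1,
      generator S1 * generator S2, generator S2 * generator S1} \<union>
     {scalar (of_real (\<chi> $ 0)) * generator P1 + scalar (of_real (\<chi> $ 1)) * generator P2
      + scalar (of_real (\<chi> $ 2)) * generator Q1 + scalar (of_real (\<chi> $ 3)) * generator Q2
      + scalar (of_real (\<chi> $ 4)) * generator S1 + scalar (of_real (\<chi> $ 5)) * generator S2
      - scalar (of_real (\<chi> $ 6))}"

text \<open>
  The set of relators is stable under \<^const>\<open>star\<close>, so the two-sided ideal it generates is a
  star-ideal and the involution descends to the quotient.
\<close>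

definition relation_ideal :: "real vec \<Rightarrow> free_alg set" where
  "relation_ideal \<chi> = genideal class_ring (relators \<chi>)"

definition alg :: "real vec \<Rightarrow> free_alg set ring" where
  "alg \<chi> = FactRing class_ring (relation_ideal \<chi>)"

definition cls :: "real vec \<Rightarrow> free_alg \<Rightarrow> free_alg set" where
  "cls \<chi> x = a_r_coset class_ring (relation_ideal \<chi>) x"


section \<open>Finite-dimensional star-representations\<close>

text \<open>
  Representations act on the Hilbert space \<open>\<complex>\<^sup>n\<close>. A ring homomorphism that
  sends the class of the scalar \<open>a\<close> to \<open>a\<close> times the identity is \<open>\<complex>\<close>-linear and unital.
\<close>

definition star_rep :: "real vec \<Rightarrow> nat \<Rightarrow> (free_alg set \<Rightarrow> complex mat) \<Rightarrow> bool" where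
  "star_rep \<chi> n \<pi> \<longleftrightarrow>
     \<pi> \<in> Ring.ring_hom (alg \<chi>) (ring_mat TYPE(complex) n ()) \<and>
     (\<forall>a. \<pi> (cls \<chi> (scalar a)) = a \<cdot>\<^sub>m 1\<^sub>m n) \<and>
     (\<forall>x. \<pi> (cls \<chi> (star x)) = mat_adjoint (\<pi> (cls \<chi> x)))"

definition irreducible_rep :: "real vec \<Rightarrow> nat \<Rightarrow> (free_alg set \<Rightarrow> complex mat) \<Rightarrow> bool" where
  "irreducible_rep \<chi> n \<pi> \<longleftrightarrow>
     0 < n \<and>
     (\<forall>W. VectorSpace.subspace class_ring W (module_vec TYPE(complex) n) \<longrightarrow>
          (\<forall>X\<in>carrier (alg \<chi>). \<forall>w\<in>W. \<pi> X *\<^sub>v w \<in> W) \<longrightarrow>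
          W = {0\<^sub>v n} \<or> W = carrier_vec n)"

definition gen_image :: "real vec \<Rightarrow> (free_alg set \<Rightarrow> complex mat) \<Rightarrow> gen \<Rightarrow> complex mat" where
  "gen_image \<chi> \<pi> g = \<pi> (cls \<chi> (generator g))"

definition nondegenerate_rep :: "real vec \<Rightarrow> nat \<Rightarrow> (free_alg set \<Rightarrow> complex mat) \<Rightarrow> bool" where
  "nondegenerate_rep \<chi> n \<pi> \<longleftrightarrow>
     (\<forall>g. gen_image \<chi> \<pi> g \<noteq> 0\<^sub>m n n) \<and>
     gen_image \<chi> \<pi> P1 + gen_image \<chi> \<pi> P2 \<noteq> 1\<^sub>m n \<and>
     gen_image \<chi> \<pi> Q1 + gen_image \<chi> \<pi> Q2 \<noteq> 1\<^sub>m n \<and>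
     gen_image \<chi> \<pi> S1 + gen_image \<chi> \<pi> S2 \<noteq> 1\<^sub>m n"

definition generalized_dim :: "real vec \<Rightarrow> nat \<Rightarrow> (free_alg set \<Rightarrow> complex mat) \<Rightarrow> int vec" where
  "generalized_dim \<chi> n \<pi> =
     vec_of_list (map (\<lambda>g. int (vec_space.rank n (gen_image \<chi> \<pi> g))) [P1, P2, Q1, Q2, S1, S2]
                  @ [int n])"


section \<open>Coxeter maps and transition matrices\<close>

text \<open>
  Vectors indexed by the vertices of the graph are written in the order
  \<open>(x\<^sub>1, \<dots>, x\<^sub>6, x\<^sub>0)\<close>. Hence \<open>x\<^sub>i\<close> is \<open>x $ (i - 1)\<close> for \<open>1 \<le> i \<le> 6\<close>, and \<open>x\<^sub>0\<close>
  is \<open>x $ 6\<close>.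
\<close>

definition c_bullet :: "real vec \<Rightarrow> real vec" where
  "c_bullet x = vec_of_list
     [- x $ 0 + x $ 1, x $ 1,
      - x $ 2 + x $ 3, x $ 3,
      - x $ 4 + x $ 5, x $ 5,
      - x $ 6 + x $ 1 + x $ 3 + x $ 5]"

definition c_circ :: "real vec \<Rightarrow> real vec" where
  "c_circ x = vec_of_list
     [x $ 0, - x $ 1 + x $ 0 + x $ 6,
      x $ 2, - x $ 3 + x $ 2 + x $ 6,
      x $ 4, - x $ 5 + x $ 4 + x $ 6,
      x $ 6]"

definition cox :: "real vec \<Rightarrow> real vec" where
  "cox = c_circ \<circ> c_bullet"

text \<open>The inverse of \<^const>\<open>cox\<close> on vectors of length 7, since both factors are involutions there.\<close>

definition cox_inv :: "real vec \<Rightarrow> real vec" where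
  "cox_inv = c_bullet \<circ> c_circ"

definition cox_pow :: "int \<Rightarrow> real vec \<Rightarrow> real vec" where
  "cox_pow z = (if 0 \<le> z then cox ^^ nat z else cox_inv ^^ nat (- z))"

definition M_f :: "real vec \<Rightarrow> real vec" where
  "M_f \<chi> = vec_of_list
     [\<chi> $ 0 - \<chi> $ 1, \<chi> $ 0,
      \<chi> $ 2 - \<chi> $ 3, \<chi> $ 2,
      \<chi> $ 4 - \<chi> $ 5, \<chi> $ 4,
      \<chi> $ 6]"

definition M_d :: "int vec \<Rightarrow> int vec" where
  "M_d x = vec_of_list
     [x $ 1 - x $ 0, x $ 0,
      x $ 3 - x $ 2, x $ 2,
      x $ 5 - x $ 4, x $ 4,
      x $ 6]"

definition delta_vec :: "int vec" where
  "delta_vec = vec_of_list [1, 2, 1, 2, 1, 2, 3]"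

text \<open>The vectors \<open>v\<^sub>1, \<dots>, v\<^sub>6\<close>, at list positions 0 to 5.\<close>

definition v_list :: "int vec list" where
  "v_list = map vec_of_list
     [[0, 1, 0, 0, 0, 0, 0],
      [1, 1, 0, 0, 0, 0, 1],
      [1, 1, 0, 1, 0, 1, 1],
      [0, 1, 1, 1, 1, 1, 2],
      [0, 1, 1, 2, 1, 2, 2],
      [1, 1, 1, 2, 1, 2, 3]]"

text \<open>
  For \<open>k \<ge> 1\<close>, writing \<open>k = 6q + r\<close> with \<open>1 \<le> r \<le> 6\<close> means
  \<open>q = (k - 1) div 6\<close> and \<open>r - 1 = (k - 1) mod 6\<close>.
\<close>

definition d_vec :: "nat \<Rightarrow> int vec" where
  "d_vec k = v_list ! ((k - 1) mod 6) + int ((k - 1) div 6) \<cdot>\<^sub>v delta_vec"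

definition D2 :: "real mat" where
  "D2 = mat_of_rows_list 7
     [[0,  0, 1, -1, 1, -1, 1],
      [0,  0, 0, -1, 0,  0, 1],
      [1, -1, 0, -1, 1, -1, 2],
      [0,  0, 0,  0, 0, -1, 1],
      [1, -1, 1, -1, 0, -1, 2],
      [2, -1, 1, -2, 1, -2, 3],
      [1, -1, 1, -2, 1, -2, 3]]"

text \<open>The matrix \<open>D\<^sub>k\<close>, for \<open>k \<ge> 6\<close>, as a linear map on vectors of length 7.\<close>

definition D_map :: "nat \<Rightarrow> real vec \<Rightarrow> real vec" where
  "D_map k \<chi> =
     (let s = k div 2 in
      if even k then D2 *\<^sub>v cox_pow (3 - int s) (M_f \<chi>)
      else D2 *\<^sub>v cox_pow (3 - int s) (c_bullet (M_f \<chi>)))"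

end

theory Submission
  imports Defs "Jordan_Normal_Form.Spectral_Radius"
begin

text \<open>
A representation with parameter \<open>\<chi>\<close> amounts to six Hermitian idempotents \<open>P g\<close>, orthogonal
within each of the three pairs, whose combination with the weights \<open>\<chi>\<close> is the scalar \<open>\<gamma>\<close>. It is
irreducible exactly when only scalars commute with all \<open>P g\<close>, and the rank of \<open>P g\<close> is its trace.
So the question is for which characters \<open>f = M_f \<chi>\<close> and which dimension vectors \<open>x\<close> such a system
with trivial commutant exists; this is \<open>realizable f x\<close> below.

Two constructions change \<open>x\<close> by one of the maps \<open>c_circ\<close>, \<open>c_bullet\<close> and \<open>f\<close> by the other one.
Replacing the sum \<open>A\<close> over a pair by \<open>\<alpha>\<^sub>1 - A\<close> is the first (\<open>realizable_c_circ\<close>). For the second,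
the maps \<open>\<surd>(w g) P g\<close>, put side by side, form up to the factor \<open>\<surd>\<gamma>\<close> a coisometry from the
direct sum of the ranges of the \<open>P g\<close> onto the Hilbert space. The compression of the same summands to
the kernel of this coisometry is again a system, in which each weight \<open>w\<close> has become \<open>\<gamma> - w\<close>
(\<open>complementary_system\<close>, \<open>realizable_c_bullet\<close>). It requires that the weights of the nonzero
projections lie strictly between \<open>0\<close> and \<open>\<gamma>\<close>. Both constructions preserve trivial commutants,
and either of them, applied twice, leads back to the same \<open>f\<close> and \<open>x\<close>.

The vectors \<open>d_k\<close> are consecutive: \<open>d_(k+1)\<close> is the image of \<open>d_k\<close> under \<open>c_bullet\<close> for odd \<open>k\<close>
and under \<open>c_circ\<close> for even \<open>k\<close> (\<open>dim_at_Suc\<close>). Hence a system for \<open>d_k\<close> can be moved to one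
for \<open>d_6\<close>, and \<open>D_k \<chi>\<close> is the matrix \<open>D2\<close> applied to the character \<open>f\<close> that results. On the
way down the restriction on the weights holds by itself: if the weights are positive and at least two of
the projections are nonzero, irreducibility forces the weight of every nonzero projection to be smaller
than \<open>\<gamma>\<close> (\<open>weight_less_total\<close>). Two further steps lead to
three projections of rank one on \<open>\<complex>\<^sup>2\<close>, and the same inequality there together with the trace identity
gives the conditions on \<open>D2 f\<close> (\<open>chamber_of_realizable\<close>). Conversely, these conditions provide a
one-dimensional system for \<open>d_3\<close>, which can be moved up as long as the weights stay in the permitted
range. They always do: twelve steps add a positive multiple of \<open>\<delta>\<close> to the character, so only
finitely many characters have to be inspected (\<open>orbit_from_chamber\<close>, \<open>decreasing_weights_up\<close>).
\<close>

section \<open>Matrices, adjoints and traces\<close>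

notation mat_adjoint (\<open>(_\<^sup>\<dagger>)\<close> [1000] 1000)

lemma dim_adjoint [simp]: "dim_row (A\<^sup>\<dagger>) = dim_col A" "dim_col (A\<^sup>\<dagger>) = dim_row A"
  by (simp_all add: mat_adjoint_def)

lemma adjoint_index [simp]:
  fixes A :: "complex mat"
  assumes "i < dim_col A" "j < dim_row A"
  shows "A\<^sup>\<dagger> $$ (i, j) = cnj (A $$ (j, i))"
  using assms by (simp add: mat_adjoint_def mat_of_rows_def col_def)

lemma adjoint_carrier [simp]: "A \<in> carrier_mat n m \<Longrightarrow> A\<^sup>\<dagger> \<in> carrier_mat m n"
  by (metis carrier_matD carrier_matI dim_adjoint)

lemma mult_index:
  "i < dim_row A \<Longrightarrow> j < dim_col B \<Longrightarrow> dim_col A = dim_row B \<Longrightarrow>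
   (A * B) $$ (i, j) = (\<Sum>k<dim_row B. A $$ (i, k) * B $$ (k, j))"
  by (simp add: scalar_prod_def atLeast0LessThan)

lemma adjoint_adjoint [simp]: fixes A :: "complex mat" shows "A\<^sup>\<dagger>\<^sup>\<dagger> = A"
  by (rule eq_matI) auto

lemma adjoint_mult:
  fixes A :: "complex mat"
  assumes "dim_col A = dim_row B"
  shows "(A * B)\<^sup>\<dagger> = B\<^sup>\<dagger> * A\<^sup>\<dagger>"
  using assms by (intro eq_matI) (auto simp: mult_index mult.commute simp del: index_mult_mat(1))

lemma adjoint_smult: "(c \<cdot>\<^sub>m A)\<^sup>\<dagger> = cnj c \<cdot>\<^sub>m A\<^sup>\<dagger>"
  by (intro eq_matI) auto

lemma adjoint_minus:
  fixes A :: "complex mat"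
  shows "dim_row A = dim_row B \<Longrightarrow> dim_col A = dim_col B \<Longrightarrow> (A - B)\<^sup>\<dagger> = A\<^sup>\<dagger> - B\<^sup>\<dagger>"
  by (intro eq_matI) auto

lemma adjoint_add:
  fixes A :: "complex mat"
  shows "dim_row A = dim_row B \<Longrightarrow> dim_col A = dim_col B \<Longrightarrow> (A + B)\<^sup>\<dagger> = A\<^sup>\<dagger> + B\<^sup>\<dagger>"
  by (intro eq_matI) auto

lemma adjoint_zero [simp]: "(0\<^sub>m n m :: complex mat)\<^sup>\<dagger> = 0\<^sub>m m n"
  by (intro eq_matI) auto

lemma adjoint_one [simp]: "(1\<^sub>m n :: complex mat)\<^sup>\<dagger> = 1\<^sub>m n"
  by (intro eq_matI) auto

text \<open>
The side conditions of the following laws contain no variables besides those of the equation, so that the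
simplifier can discharge them by computing dimensions.
\<close>

lemma mat_mult_assoc:
  fixes A :: "'a :: semiring_0 mat"
  assumes "dim_col A = dim_row B" "dim_col B = dim_row C"
  shows "(A * B) * C = A * (B * C)"
  by (rule assoc_mult_mat[of A "dim_row A" "dim_col A" B "dim_col B" C "dim_col C"]) (use assms in auto)

lemma mat_add_mult:
  fixes A :: "'a :: semiring_0 mat"
  assumes "dim_row A = dim_row B" "dim_col A = dim_col B" "dim_col B = dim_row C"
  shows "(A + B) * C = A * C + B * C"
  by (rule add_mult_distrib_mat[of A "dim_row A" "dim_col A" B C "dim_col C"]) (use assms in auto)

lemma mat_mult_add:
  fixes A :: "'a :: semiring_0 mat"
  assumes "dim_row B = dim_row C" "dim_col B = dim_col C" "dim_col A = dim_row B"
  shows "A * (B + C) = A * B + A * C"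
  by (rule mult_add_distrib_mat[of A "dim_row A" "dim_col A" B "dim_col B" C]) (use assms in auto)

lemma mat_minus_mult:
  fixes A :: "'a :: ring mat"
  assumes "dim_row A = dim_row B" "dim_col A = dim_col B" "dim_col B = dim_row C"
  shows "(A - B) * C = A * C - B * C"
  by (rule minus_mult_distrib_mat[of A "dim_row A" "dim_col A" B C "dim_col C"]) (use assms in auto)

lemma mat_mult_minus:
  fixes A :: "'a :: ring mat"
  assumes "dim_row B = dim_row C" "dim_col B = dim_col C" "dim_col A = dim_row B"
  shows "A * (B - C) = A * B - A * C"
  by (rule mult_minus_distrib_mat[of A "dim_row A" "dim_col A" B "dim_col B" C]) (use assms in auto)

lemma mat_smult_mult:
  fixes A :: "'a :: comm_semiring_0 mat"
  assumes "dim_col A = dim_row B"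
  shows "(c \<cdot>\<^sub>m A) * B = c \<cdot>\<^sub>m (A * B)"
  by (rule mult_smult_assoc_mat[of A "dim_row A" "dim_col A" B "dim_col B"]) (use assms in auto)

lemma mat_mult_smult:
  fixes A :: "'a :: comm_semiring_0 mat"
  assumes "dim_col A = dim_row B"
  shows "A * (c \<cdot>\<^sub>m B) = c \<cdot>\<^sub>m (A * B)"
  by (rule mult_smult_distrib[of A "dim_row A" "dim_col A" B "dim_col B"]) (use assms in auto)

lemma smult_smult_mat: "a \<cdot>\<^sub>m (b \<cdot>\<^sub>m A) = (a * b) \<cdot>\<^sub>m (A :: 'a :: semigroup_mult mat)"
  by (intro eq_matI) (auto simp: mult.assoc)

lemma one_smult_mat [simp]: "1 \<cdot>\<^sub>m A = (A :: complex mat)"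
  by (intro eq_matI) auto

lemmas mat_ring_simps = mat_mult_assoc mat_add_mult mat_mult_add mat_minus_mult mat_mult_minus
  mat_smult_mult mat_mult_smult smult_smult_mat

definition tr :: "complex mat \<Rightarrow> complex" where
  "tr A = (\<Sum>i<dim_row A. A $$ (i, i))"

lemma tr_mult_commute:
  assumes "dim_col A = dim_row B" "dim_row A = dim_col B"
  shows "tr (A * B) = tr (B * A)"
proof -
  have "tr (A * B) = (\<Sum>i<dim_row A. \<Sum>k<dim_row B. A $$ (i, k) * B $$ (k, i))"
    using assms by (simp add: tr_def mult_index del: index_mult_mat(1))
  also have "\<dots> = (\<Sum>k<dim_row B. \<Sum>i<dim_row A. B $$ (k, i) * A $$ (i, k))"
    by (subst sum.swap) (simp add: mult.commute)
  also have "\<dots> = tr (B * A)"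
    using assms by (simp add: tr_def mult_index del: index_mult_mat(1))
  finally show ?thesis .
qed

lemma tr_smult: "dim_col A = dim_row A \<Longrightarrow> tr (c \<cdot>\<^sub>m A) = c * tr A"
  by (simp add: tr_def sum_distrib_left)

lemma tr_minus: "dim_row A = dim_row B \<Longrightarrow> dim_col B = dim_row B \<Longrightarrow> tr (A - B) = tr A - tr B"
  by (simp add: tr_def sum_subtractf)

lemma tr_add: "dim_row A = dim_row B \<Longrightarrow> dim_col B = dim_row B \<Longrightarrow> tr (A + B) = tr A + tr B"
  by (simp add: tr_def sum.distrib)

lemma tr_one [simp]: "tr (1\<^sub>m n) = of_nat n"
  by (simp add: tr_def)

lemma tr_zero [simp]: "tr (0\<^sub>m n n) = 0"
  by (simp add: tr_def)

text \<open>
Traces of this form are squared Frobenius norms: nonnegative, and zero only for the zero matrix.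
\<close>

lemma tr_adjoint_mult:
  "tr (A\<^sup>\<dagger> * A) = of_real (\<Sum>i<dim_col A. \<Sum>k<dim_row A. (cmod (A $$ (k, i)))\<^sup>2)"
  by (simp add: tr_def mult_index complex_norm_square mult.commute del: index_mult_mat(1) of_real_power)

lemma tr_adjoint_mult_eq_0:
  assumes "tr (A\<^sup>\<dagger> * A) = 0"
  shows "A = 0\<^sub>m (dim_row A) (dim_col A)"
proof (rule eq_matI)
  fix i j assume "i < dim_row (0\<^sub>m (dim_row A) (dim_col A) :: complex mat)"
    "j < dim_col (0\<^sub>m (dim_row A) (dim_col A) :: complex mat)"
  moreover have "\<forall>i<dim_col A. (\<Sum>k<dim_row A. (cmod (A $$ (k, i)))\<^sup>2) = 0"
    using assms unfolding tr_adjoint_mult of_real_eq_0_iff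
    by (subst (asm) sum_nonneg_eq_0_iff) (auto intro: sum_nonneg)
  ultimately show "A $$ (i, j) = 0\<^sub>m (dim_row A) (dim_col A) $$ (i, j)"
    by (auto simp: sum_nonneg_eq_0_iff)
qed auto

definition hermitian_idempotent :: "nat \<Rightarrow> complex mat \<Rightarrow> bool" where
  "hermitian_idempotent n P \<longleftrightarrow> P \<in> carrier_mat n n \<and> P\<^sup>\<dagger> = P \<and> P * P = P"

lemma tr_hermitian_idempotent_eq_0_iff:
  assumes "hermitian_idempotent n P"
  shows "tr P = 0 \<longleftrightarrow> P = 0\<^sub>m n n"
  using assms tr_adjoint_mult_eq_0[of P] by (auto simp: hermitian_idempotent_def)

section \<open>Subspaces of \<open>\<complex>\<^sup>n\<close> and Hermitian idempotents\<close>

text \<open>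
The trace of the idempotent \<open>1 - W\<^sup>\<dagger> W\<close> is \<open>n - m\<close>, and it is a squared norm.
\<close>

lemma isometry_dim_le:
  fixes W :: "complex mat"
  assumes W: "W \<in> carrier_mat m n" and iso: "W * W\<^sup>\<dagger> = 1\<^sub>m m"
  shows "m \<le> n"
proof -
  note [simp] = carrier_matD[OF W]
  define R where "R = 1\<^sub>m n - W\<^sup>\<dagger> * W"
  have "W\<^sup>\<dagger> * (W * (W\<^sup>\<dagger> * W)) = W\<^sup>\<dagger> * ((W * W\<^sup>\<dagger>) * W)"
    by (simp add: mat_mult_assoc)
  also have "\<dots> = W\<^sup>\<dagger> * W"
    using W by (simp add: iso)
  finally have "W\<^sup>\<dagger> * (W * (W\<^sup>\<dagger> * W)) = W\<^sup>\<dagger> * W" .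
  then have "R\<^sup>\<dagger> * R = R"
    by (auto simp: R_def mat_ring_simps adjoint_minus adjoint_mult)
  moreover have "tr R = of_nat n - of_nat m"
    using tr_mult_commute[of W "W\<^sup>\<dagger>"] by (simp add: R_def tr_minus iso)
  ultimately have "of_real (\<Sum>i<dim_col R. \<Sum>k<dim_row R. (cmod (R $$ (k, i)))\<^sup>2) = (of_real (real n - real m) :: complex)"
    using tr_adjoint_mult[of R] by simp
  then have "real n - real m = (\<Sum>i<dim_col R. \<Sum>k<dim_row R. (cmod (R $$ (k, i)))\<^sup>2)"
    using of_real_eq_iff by metis
  also have "\<dots> \<ge> 0"
    by (intro sum_nonneg) auto
  finally show ?thesis by simp
qed

lemma mat_mult_vec_assoc:
  fixes A :: "'a :: semiring_0 mat"
  assumes "dim_col A = dim_row B" "dim_col B = dim_vec v"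
  shows "(A * B) *\<^sub>v v = A *\<^sub>v (B *\<^sub>v v)"
  by (rule assoc_mult_mat_vec[of A "dim_row A" "dim_col A" B "dim_col B"]) (use assms in auto)

lemma mult_vec_index:
  "i < dim_row A \<Longrightarrow> dim_col A = dim_vec v \<Longrightarrow> (A *\<^sub>v v) $ i = (\<Sum>k<dim_vec v. A $$ (i, k) * v $ k)"
  by (simp add: scalar_prod_def atLeast0LessThan)

text \<open>
One step of the Gram--Schmidt process: if the orthonormal columns of \<open>W\<^sup>\<dagger>\<close> do not yet span \<open>S\<close>, then
the part of a missing vector \<open>v\<close> orthogonal to them provides one more column.
\<close>

lemma coisometry_extend:
  fixes S :: "complex vec set"
  assumes S: "S \<subseteq> carrier_vec n" "0\<^sub>v n \<in> S"
    and add: "\<And>u v. u \<in> S \<Longrightarrow> v \<in> S \<Longrightarrow> u + v \<in> S"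
    and smult: "\<And>c v. v \<in> S \<Longrightarrow> c \<cdot>\<^sub>v v \<in> S"
    and W: "W \<in> carrier_mat m n" "W * W\<^sup>\<dagger> = 1\<^sub>m m" "\<And>c. c \<in> carrier_vec m \<Longrightarrow> W\<^sup>\<dagger> *\<^sub>v c \<in> S"
    and v: "v \<in> S" "W\<^sup>\<dagger> *\<^sub>v (W *\<^sub>v v) \<noteq> v"
  shows "\<exists>W'. W' \<in> carrier_mat (Suc m) n \<and> W' * W'\<^sup>\<dagger> = 1\<^sub>m (Suc m) \<and>
           (\<forall>c \<in> carrier_vec (Suc m). W'\<^sup>\<dagger> *\<^sub>v c \<in> S)"
proof -
  note [simp] = carrier_matD[OF W(1)]
  have vn [simp]: "dim_vec v = n" using v S by auto
  define w where "w = v + (-1) \<cdot>\<^sub>v (W\<^sup>\<dagger> *\<^sub>v (W *\<^sub>v v))"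
  have wn [simp]: "dim_vec w = n" by (simp add: w_def)
  have wS: "w \<in> S"
    unfolding w_def by (intro add smult v W(3)) (simp add: carrier_dim_vec)
  have "W *\<^sub>v (W\<^sup>\<dagger> *\<^sub>v (W *\<^sub>v v)) = (W * W\<^sup>\<dagger>) *\<^sub>v (W *\<^sub>v v)"
    by (simp add: mat_mult_vec_assoc)
  also have "\<dots> = W *\<^sub>v v" unfolding W(2) by (rule one_mult_mat_vec) (simp add: carrier_dim_vec)
  finally have "W *\<^sub>v (W\<^sup>\<dagger> *\<^sub>v (W *\<^sub>v v)) = W *\<^sub>v v" .
  moreover have "W *\<^sub>v w = W *\<^sub>v v + (-1) \<cdot>\<^sub>v (W *\<^sub>v (W\<^sup>\<dagger> *\<^sub>v (W *\<^sub>v v)))"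
    unfolding w_def by (subst mult_add_distrib_mat_vec[OF W(1)]) 
      (auto simp: carrier_dim_vec intro!: arg_cong2[of _ _ _ _ "(+)"] mult_mat_vec[OF W(1)])
  ultimately have Ww: "W *\<^sub>v w = 0\<^sub>v m"
    by (auto intro!: eq_vecI)
  have w0: "w \<noteq> 0\<^sub>v n"
  proof
    assume w: "w = 0\<^sub>v n"
    have "v $ i = (W\<^sup>\<dagger> *\<^sub>v (W *\<^sub>v v)) $ i" if "i < n" for i
      using arg_cong[OF w, of "\<lambda>x. x $ i"] that by (simp add: w_def)
    then have "v = W\<^sup>\<dagger> *\<^sub>v (W *\<^sub>v v)" by (intro eq_vecI) auto
    with v show False by simp
  qed
  define r where "r = sqrt (\<Sum>k<n. (cmod (w $ k))\<^sup>2)"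
  have "(\<Sum>k<n. (cmod (w $ k))\<^sup>2) \<noteq> 0"
  proof
    assume "(\<Sum>k<n. (cmod (w $ k))\<^sup>2) = 0"
    then have "w = 0\<^sub>v n" by (auto simp: sum_nonneg_eq_0_iff intro!: eq_vecI)
    with w0 show False ..
  qed
  then have r: "r > 0" "r\<^sup>2 = (\<Sum>k<n. (cmod (w $ k))\<^sup>2)"
    by (auto simp: r_def sum_nonneg less_le)
  define u where "u = (1 / of_real r) \<cdot>\<^sub>v w"
  have [simp]: "dim_vec u = n" by (simp add: u_def)
  have uS: "u \<in> S" unfolding u_def by (intro smult wS)
  have Wu: "(\<Sum>k<n. W $$ (i, k) * u $ k) = 0" if "i < m" for i
  proof -
    have "(\<Sum>k<n. W $$ (i, k) * w $ k) = (W *\<^sub>v w) $ i"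
      using that by (simp add: mult_vec_index del: index_mult_mat_vec)
    then show ?thesis using that
      by (simp add: Ww u_def flip: sum_divide_distrib)
  qed
  have Wu': "(\<Sum>k<n. cnj (u $ k) * cnj (W $$ (i, k))) = 0" if "i < m" for i
    using arg_cong[OF Wu[OF that], of cnj] by (simp add: mult.commute)
  have uu: "(\<Sum>k<n. cnj (u $ k) * u $ k) = 1"
  proof -
    have "(\<Sum>k<n. cnj (u $ k) * u $ k) = (\<Sum>k<n. of_real ((cmod (w $ k))\<^sup>2) / of_real (r\<^sup>2))"
      by (intro sum.cong) (auto simp: u_def power2_eq_square complex_norm_square[symmetric] mult.commute
          simp flip: of_real_mult complex_norm_square)
    also have "\<dots> = of_real (r\<^sup>2) / of_real (r\<^sup>2)"
      by (simp add: r(2) flip: sum_divide_distrib)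
    finally show ?thesis using r(1) by simp
  qed
  have WW: "(\<Sum>k<n. W $$ (i, k) * cnj (W $$ (j, k))) = (if i = j then 1 else 0)" if "i < m" "j < m" for i j
    using arg_cong[OF W(2), of "\<lambda>A. A $$ (i, j)"] that by (simp add: mult_index del: index_mult_mat(1))
  define W' where "W' = mat (Suc m) n (\<lambda>(i, j). if i < m then W $$ (i, j) else cnj (u $ j))"
  have "W' * W'\<^sup>\<dagger> = 1\<^sub>m (Suc m)"
    by (rule eq_matI) 
      (auto simp: W'_def mult_index WW Wu' Wu[unfolded mult.commute[of "W $$ _"]] uu[unfolded mult.commute[of "cnj (u $ _)"]]
      mult.commute less_Suc_eq simp del: index_mult_mat(1))
  moreover have "W'\<^sup>\<dagger> *\<^sub>v c \<in> S" if c: "c \<in> carrier_vec (Suc m)" for c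
  proof -
    have "W'\<^sup>\<dagger> *\<^sub>v c = W\<^sup>\<dagger> *\<^sub>v vec m (\<lambda>i. c $ i) + c $ m \<cdot>\<^sub>v u"
      using c by (intro eq_vecI)
        (auto simp: W'_def mult_vec_index sum.lessThan_Suc mult.commute simp del: index_mult_mat_vec)
    then show ?thesis using W(3) uS add smult by simp
  qed
  ultimately show ?thesis
    by (intro exI[of _ W']) (auto simp: W'_def)
qed

text \<open>
There is a \<open>W\<^sup>\<dagger>\<close> with as many orthonormal columns from \<open>S\<close> as possible, because \<open>n\<close> bounds
their number. By maximality \<open>W\<^sup>\<dagger> W\<close> is then the orthogonal projection onto \<open>S\<close>.
\<close>

theorem subspace_coisometry:
  fixes S :: "complex vec set"
  assumes S: "S \<subseteq> carrier_vec n" "0\<^sub>v n \<in> S"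
    and add: "\<And>u v. u \<in> S \<Longrightarrow> v \<in> S \<Longrightarrow> u + v \<in> S"
    and smult: "\<And>c v. v \<in> S \<Longrightarrow> c \<cdot>\<^sub>v v \<in> S"
  obtains m W where "W \<in> carrier_mat m n" "W * W\<^sup>\<dagger> = 1\<^sub>m m"
    "S = {v \<in> carrier_vec n. (W\<^sup>\<dagger> * W) *\<^sub>v v = v}"
proof -
  define good where "good m \<longleftrightarrow> (\<exists>W. W \<in> carrier_mat m n \<and> W * W\<^sup>\<dagger> = 1\<^sub>m m \<and>
           (\<forall>c \<in> carrier_vec m. W\<^sup>\<dagger> *\<^sub>v c \<in> S))" for m
  have "good 0"
    unfolding good_def
  proof (intro exI[of _ "0\<^sub>m 0 n"] conjI ballI)
    fix c :: "complex vec" assume "c \<in> carrier_vec 0"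
    then have "(0\<^sub>m 0 n)\<^sup>\<dagger> *\<^sub>v c = 0\<^sub>v n" by (intro eq_vecI) (auto simp: scalar_prod_def)
    then show "(0\<^sub>m 0 n)\<^sup>\<dagger> *\<^sub>v c \<in> S" using S(2) by simp
  qed (auto intro!: eq_matI)
  moreover have le: "\<forall>m. good m \<longrightarrow> m \<le> n"
    using isometry_dim_le by (auto simp: good_def)
  define m where "m = Greatest good"
  have m: "good m" and max: "\<not> good (Suc m)"
    using GreatestI_nat[of good 0 n] Greatest_le_nat[of good "Suc m" n] \<open>good 0\<close> le by (auto simp: m_def)
  then obtain W where W: "W \<in> carrier_mat m n" "W * W\<^sup>\<dagger> = 1\<^sub>m m"
    "\<And>c. c \<in> carrier_vec m \<Longrightarrow> W\<^sup>\<dagger> *\<^sub>v c \<in> S"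
    unfolding good_def by blast
  note [simp] = carrier_matD[OF W(1)]
  have "S = {v \<in> carrier_vec n. (W\<^sup>\<dagger> * W) *\<^sub>v v = v}"
  proof (intro equalityI subsetI CollectI conjI)
    fix v assume "v \<in> S"
    show "v \<in> carrier_vec n" using \<open>v \<in> S\<close> S by auto
    then have "(W\<^sup>\<dagger> * W) *\<^sub>v v = W\<^sup>\<dagger> *\<^sub>v (W *\<^sub>v v)" by (auto simp: mat_mult_vec_assoc)
    then show "(W\<^sup>\<dagger> * W) *\<^sub>v v = v"
      using coisometry_extend[OF S add smult W \<open>v \<in> S\<close>] max unfolding good_def by metis
  next
    fix v assume "v \<in> {v \<in> carrier_vec n. (W\<^sup>\<dagger> * W) *\<^sub>v v = v}"
    then have v: "v \<in> carrier_vec n" "(W\<^sup>\<dagger> * W) *\<^sub>v v = v" by auto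
    have "W\<^sup>\<dagger> *\<^sub>v (W *\<^sub>v v) \<in> S" by (intro W(3)) (simp add: carrier_dim_vec)
    then show "v \<in> S" using v by (auto simp: mat_mult_vec_assoc)
  qed
  then show thesis using W that by blast
qed

lemma mat_eqI_mult_vec:
  fixes A B :: "complex mat"
  assumes "A \<in> carrier_mat n m" "B \<in> carrier_mat n m"
    and eq: "\<And>v. v \<in> carrier_vec m \<Longrightarrow> A *\<^sub>v v = B *\<^sub>v v"
  shows "A = B"
proof (rule eq_matI)
  fix i j assume "i < dim_row B" "j < dim_col B"
  then show "A $$ (i, j) = B $$ (i, j)"
    using arg_cong[OF eq[of "unit_vec m j"], of "\<lambda>v. v $ i"] assms(1,2) by auto
qed (use assms in auto)

text \<open>
\<open>P\<close> and the projection \<open>W\<^sup>\<dagger> W\<close> onto its range fix the same vectors, so each absorbs the other;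
taking adjoints shows that they are equal. Factoring idempotents in this way replaces orthonormal bases
of their ranges.
\<close>

theorem hermitian_idempotent_factor:
  assumes P: "hermitian_idempotent n P"
  obtains m W where "W \<in> carrier_mat m n" "W * W\<^sup>\<dagger> = 1\<^sub>m m" "W\<^sup>\<dagger> * W = P" "tr P = of_nat m"
proof -
  have Pc: "P \<in> carrier_mat n n" and adj: "P\<^sup>\<dagger> = P" and idem: "P * P = P"
    using P by (auto simp: hermitian_idempotent_def)
  note [simp] = carrier_matD[OF Pc]
  let ?S = "{v \<in> carrier_vec n. P *\<^sub>v v = v}"
  obtain m W where W: "W \<in> carrier_mat m n" "W * W\<^sup>\<dagger> = 1\<^sub>m m"
    and S: "?S = {v \<in> carrier_vec n. (W\<^sup>\<dagger> * W) *\<^sub>v v = v}"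
  proof (rule subspace_coisometry[of ?S n])
    show "0\<^sub>v n \<in> ?S" by (auto simp: scalar_prod_def intro!: eq_vecI)
    show "u + v \<in> ?S" if "u \<in> ?S" "v \<in> ?S" for u v
      using that by (auto simp: mult_add_distrib_mat_vec[OF Pc])
    show "c \<cdot>\<^sub>v v \<in> ?S" if "v \<in> ?S" for c v
      using that mult_mat_vec[OF Pc] by auto
  qed auto
  note [simp] = carrier_matD[OF W(1)]
  define Q where "Q = W\<^sup>\<dagger> * W"
  have Qc: "Q \<in> carrier_mat n n" unfolding Q_def by (intro carrier_matI) simp_all
  have "W\<^sup>\<dagger> * W * (W\<^sup>\<dagger> * W) = W\<^sup>\<dagger> * ((W * W\<^sup>\<dagger>) * W)" by (simp add: mat_mult_assoc)
  then have QQ: "Q * Q = Q" unfolding W(2) Q_def using W(1) by simp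
  have Qadj: "Q\<^sup>\<dagger> = Q" by (simp add: Q_def adjoint_mult)
  have fixed: "A * B = B" if A: "A \<in> carrier_mat n n" and B: "B \<in> carrier_mat n n"
      and AB: "{v \<in> carrier_vec n. A *\<^sub>v v = v} = {v \<in> carrier_vec n. B *\<^sub>v v = v}" and BB: "B * B = B"
    for A B :: "complex mat"
  proof (rule mat_eqI_mult_vec[of _ n n])
    fix v :: "complex vec" assume v: "v \<in> carrier_vec n"
    have "B *\<^sub>v (B *\<^sub>v v) = B *\<^sub>v v"
      using BB A B v assoc_mult_mat_vec[of B n n B n v] by simp
    then have "B *\<^sub>v v \<in> {v \<in> carrier_vec n. A *\<^sub>v v = v}"
      unfolding AB using B v by simp
    then have "A *\<^sub>v (B *\<^sub>v v) = B *\<^sub>v v" by simp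
    then show "(A * B) *\<^sub>v v = B *\<^sub>v v" using A B v by simp
  qed (use A B in auto)
  have "P * Q = Q" using fixed[OF Pc Qc _ QQ] S by (simp add: Q_def)
  moreover have "Q * P = P" using fixed[OF Qc Pc _ idem] S by (simp add: Q_def)
  ultimately have "Q = P"
    using adjoint_mult[of P Q] Qc Pc adj Qadj by simp
  moreover have "tr Q = of_nat m"
    using tr_mult_commute[of W "W\<^sup>\<dagger>"] by (simp add: Q_def W(2))
  ultimately show thesis using W that[of W m] by (simp add: Q_def)
qed

lemma range_subset_imp_span_cols_subset:
  fixes A B C :: "complex mat"
  assumes A: "A \<in> carrier_mat n k" and B: "B \<in> carrier_mat n l" and C: "C \<in> carrier_mat l k"
    and "A = B * C"
  shows "LinearCombinations.module.span class_ring (module_vec TYPE(complex) n) (set (cols A)) \<subseteq>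
         LinearCombinations.module.span class_ring (module_vec TYPE(complex) n) (set (cols B))"
proof -
  interpret vec_space "TYPE(complex)" n .
  have Bc: "set (cols B) \<subseteq> carrier_vec n" using B cols_dim[of B] by auto
  have "set (cols A) \<subseteq> span (set (cols B))"
  proof
    fix v assume "v \<in> set (cols A)"
    then obtain j where j: "j < k" "v = col A j"
      using A by (auto simp: cols_def)
    have "v = B *\<^sub>v col C j"
      using j assms by (auto simp: col_mult2[of B n l C k])
    also have "\<dots> = mat_of_cols n (cols B) *\<^sub>v vec (length (cols B)) (\<lambda>i. col C j $ i)"
      using B C mat_of_cols_cols[of B] by (intro arg_cong2[of _ _ _ _ "(*\<^sub>v)"]) auto
    also have "\<dots> = lincomb_list (\<lambda>i. col C j $ i) (cols B)"
      using Bc by (subst lincomb_list_as_mat_mult) auto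
    also have "\<dots> \<in> span_list (cols B)" by (rule in_span_listI) auto
    also have "\<dots> = span (set (cols B))" using Bc by (rule span_list_as_span)
    finally show "v \<in> span (set (cols B))" .
  qed
  then show ?thesis
    by (rule span_subsetI[OF Bc])
qed

lemma mat_mult_unit_vec_col:
  fixes A :: "complex mat"
  shows "A \<in> carrier_mat n m \<Longrightarrow> i < m \<Longrightarrow> A *\<^sub>v unit_vec m i = col A i"
  by (intro eq_vecI) auto

text \<open>
With \<open>P = W\<^sup>\<dagger> W\<close> the columns of \<open>P\<close> span the same space as the \<open>m\<close> orthonormal columns of
\<open>W\<^sup>\<dagger>\<close>, while \<open>tr P = tr (W W\<^sup>\<dagger>) = m\<close>. All dimension counts below are therefore traces.
\<close>

theorem rank_hermitian_idempotent:
  assumes P: "hermitian_idempotent n P"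
  shows "of_nat (vec_space.rank n P) = tr P"
proof -
  interpret vec_space "TYPE(complex)" n .
  obtain m W where W: "W \<in> carrier_mat m n" "W * W\<^sup>\<dagger> = 1\<^sub>m m" "W\<^sup>\<dagger> * W = P" "tr P = of_nat m"
    using hermitian_idempotent_factor[OF P] .
  note [simp] = carrier_matD[OF W(1)]
  let ?U = "W\<^sup>\<dagger>"
  have Pc: "P \<in> carrier_mat n n" using P by (simp add: hermitian_idempotent_def)
  have Uc: "?U \<in> carrier_mat n m" using W by auto
  have "P * ?U = ?U * (W * ?U)" unfolding W(3)[symmetric] by (rule mat_mult_assoc) simp_all
  then have UP: "?U = P * ?U" using Uc by (simp add: W(2))
  have "span (set (cols P)) = span (set (cols ?U))"
    by (rule equalityI[OF range_subset_imp_span_cols_subset[OF Pc Uc W(1) W(3)[symmetric]]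
          range_subset_imp_span_cols_subset[OF Uc Pc Uc UP]])
  then have "rank P = rank ?U" by (simp only: rank_def)
  moreover have inj: "v = 0\<^sub>v m" if "v \<in> carrier_vec m" "?U *\<^sub>v v = 0\<^sub>v n" for v
  proof -
    have "v = (W * ?U) *\<^sub>v v" using that W(2) by simp
    also have "\<dots> = W *\<^sub>v 0\<^sub>v n" using that by (simp add: mat_mult_vec_assoc)
    also have "\<dots> = 0\<^sub>v m" using W(1) by auto
    finally show ?thesis .
  qed
  have "distinct (cols ?U)"
  proof (subst distinct_conv_nth, intro allI impI notI)
    fix i j assume ij: "i < length (cols ?U)" "j < length (cols ?U)" "i \<noteq> j" "cols ?U ! i = cols ?U ! j"
    then have "col ?U i = col ?U j" "i < m" "j < m" by simp_all
    then have "?U *\<^sub>v unit_vec m i = ?U *\<^sub>v unit_vec m j"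
      by (metis (no_types, lifting) Uc mat_mult_unit_vec_col)
    then have "?U *\<^sub>v (unit_vec m i - unit_vec m j) = 0\<^sub>v n"
      using Uc by (auto simp: mult_minus_distrib_mat_vec[OF Uc])
    then have "unit_vec m i - unit_vec m j = (0\<^sub>v m :: complex vec)" by (intro inj) auto
    from arg_cong[OF this, of "\<lambda>v. v $ i"] ij show False by simp
  qed
  then have "rank ?U = m"
    by (intro lin_indpt_full_rank[OF Uc]) (auto elim!: lin_depE[OF Uc] dest: inj)
  ultimately show ?thesis using W by simp
qed

section \<open>Systems of projections with a scalar combination\<close>

lemma UNIV_gen: "UNIV = {P1, P2, Q1, Q2, S1, S2}"
  using gen.exhaust by auto

instance gen :: finite
  by standard (simp add: UNIV_gen)

lemma sum_gen: "(\<Sum>g\<in>UNIV. F g) = F P1 + F P2 + F Q1 + F Q2 + F S1 + F S2"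
  for F :: "gen \<Rightarrow> 'a :: comm_monoid_add"
  by (simp add: UNIV_gen add.assoc)

fun partner :: "gen \<Rightarrow> gen" where
  "partner P1 = P2" | "partner P2 = P1" | "partner Q1 = Q2" | "partner Q2 = Q1"
| "partner S1 = S2" | "partner S2 = S1"

lemma partner_partner [simp]: "partner (partner g) = g"
  by (cases g) auto

lemma partner_neq [simp]: "partner g \<noteq> g"
  by (cases g) auto

lemma sum_partner: "(\<Sum>g\<in>UNIV. F (partner g)) = (\<Sum>g\<in>UNIV. F g)"
  for F :: "gen \<Rightarrow> 'a :: comm_monoid_add"
  by (simp add: sum_gen ac_simps)

text \<open>
Matrices of unspecified size form no additive monoid, hence no \<^const>\<open>sum\<close>; the size is an argument.
\<close>

definition gsum :: "nat \<Rightarrow> nat \<Rightarrow> (gen \<Rightarrow> complex mat) \<Rightarrow> complex mat" where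
  "gsum n m F = mat n m (\<lambda>(i, j). \<Sum>g\<in>UNIV. F g $$ (i, j))"

lemma gsum_dim [simp]: "dim_row (gsum n m F) = n" "dim_col (gsum n m F) = m"
  by (simp_all add: gsum_def)

lemma gsum_carrier [simp]: "gsum n m F \<in> carrier_mat n m"
  by (simp add: gsum_def)

lemma gsum_index [simp]: "i < n \<Longrightarrow> j < m \<Longrightarrow> gsum n m F $$ (i, j) = (\<Sum>g\<in>UNIV. F g $$ (i, j))"
  by (simp add: gsum_def)

lemma gsum_mult:
  assumes "\<And>g. F g \<in> carrier_mat n m" "dim_row B = m"
  shows "gsum n m F * B = gsum n (dim_col B) (\<lambda>g. F g * B)"
proof (rule eq_matI)
  fix i j assume "i < dim_row (gsum n (dim_col B) (\<lambda>g. F g * B))" "j < dim_col (gsum n (dim_col B) (\<lambda>g. F g * B))"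
  moreover have "dim_row (F g) = n" "dim_col (F g) = m" for g using assms(1)[of g] by auto
  ultimately show "(gsum n m F * B) $$ (i, j) = gsum n (dim_col B) (\<lambda>g. F g * B) $$ (i, j)"
    using assms(2)
    by (simp add: mult_index sum_distrib_right sum.swap[of _ "{..<_}" UNIV] del: index_mult_mat(1))
qed auto

lemma mult_gsum:
  assumes "\<And>g. F g \<in> carrier_mat n m" "dim_col A = n"
  shows "A * gsum n m F = gsum (dim_row A) m (\<lambda>g. A * F g)"
proof (rule eq_matI)
  fix i j assume "i < dim_row (gsum (dim_row A) m (\<lambda>g. A * F g))" "j < dim_col (gsum (dim_row A) m (\<lambda>g. A * F g))"
  moreover have "dim_row (F g) = n" "dim_col (F g) = m" for g using assms(1)[of g] by auto
  ultimately show "(A * gsum n m F) $$ (i, j) = gsum (dim_row A) m (\<lambda>g. A * F g) $$ (i, j)"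
    using assms(2)
    by (simp add: mult_index sum_distrib_left sum.swap[of _ "{..<_}" UNIV] del: index_mult_mat(1))
qed auto

lemma smult_gsum:
  assumes "\<And>g. F g \<in> carrier_mat n m"
  shows "c \<cdot>\<^sub>m gsum n m F = gsum n m (\<lambda>g. c \<cdot>\<^sub>m F g)"
proof (rule eq_matI)
  have "dim_row (F g) = n" "dim_col (F g) = m" for g using assms(1)[of g] by auto
  then show "(c \<cdot>\<^sub>m gsum n m F) $$ (i, j) = gsum n m (\<lambda>g. c \<cdot>\<^sub>m F g) $$ (i, j)"
    if "i < dim_row (gsum n m (\<lambda>g. c \<cdot>\<^sub>m F g))" "j < dim_col (gsum n m (\<lambda>g. c \<cdot>\<^sub>m F g))" for i j
    using that by (simp add: sum_distrib_left)
qed auto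

lemma adjoint_gsum:
  assumes "\<And>g. F g \<in> carrier_mat n m"
  shows "(gsum n m F)\<^sup>\<dagger> = gsum m n (\<lambda>g. (F g)\<^sup>\<dagger>)"
proof (rule eq_matI)
  have "dim_row (F g) = n" "dim_col (F g) = m" for g using assms(1)[of g] by auto
  then show "(gsum n m F)\<^sup>\<dagger> $$ (i, j) = gsum m n (\<lambda>g. (F g)\<^sup>\<dagger>) $$ (i, j)"
    if "i < dim_row (gsum m n (\<lambda>g. (F g)\<^sup>\<dagger>))" "j < dim_col (gsum m n (\<lambda>g. (F g)\<^sup>\<dagger>))" for i j
    using that by simp
qed auto

lemma tr_gsum:
  assumes "\<And>g. F g \<in> carrier_mat n n"
  shows "tr (gsum n n F) = (\<Sum>g\<in>UNIV. tr (F g))"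
proof -
  have "dim_row (F g) = n" for g using assms(1)[of g] by auto
  then show ?thesis by (simp add: tr_def sum.swap[of _ "{..<_}" UNIV])
qed

lemma gsum_delta:
  assumes "F g \<in> carrier_mat n m" "\<And>h. h \<noteq> g \<Longrightarrow> F h = 0\<^sub>m n m"
  shows "gsum n m F = F g"
proof (rule eq_matI)
  fix i j assume ij: "i < dim_row (F g)" "j < dim_col (F g)"
  have "(\<Sum>h\<in>UNIV. F h $$ (i, j)) = (\<Sum>h\<in>UNIV. if h = g then F g $$ (i, j) else 0)"
    using ij assms by (intro sum.cong) auto
  then show "gsum n m F $$ (i, j) = F g $$ (i, j)" using ij assms(1) by simp
qed (use assms(1) in auto)

lemma smult_one_mult:
  fixes A :: "complex mat"
  assumes "A \<in> carrier_mat n m"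
  shows "(c \<cdot>\<^sub>m 1\<^sub>m n) * A = c \<cdot>\<^sub>m A" "A * (c \<cdot>\<^sub>m 1\<^sub>m m) = c \<cdot>\<^sub>m A"
  using assms mult_smult_assoc_mat[of "1\<^sub>m n" n n A m c] mult_smult_distrib[of A n m "1\<^sub>m m" m c] by simp_all

definition projection_system :: "(gen \<Rightarrow> real) \<Rightarrow> real \<Rightarrow> nat \<Rightarrow> (gen \<Rightarrow> complex mat) \<Rightarrow> bool" where
  "projection_system w \<gamma> n P \<longleftrightarrow>
     (\<forall>g. hermitian_idempotent n (P g)) \<and> (\<forall>g. P g * P (partner g) = 0\<^sub>m n n) \<and>
     gsum n n (\<lambda>g. of_real (w g) \<cdot>\<^sub>m P g) = of_real \<gamma> \<cdot>\<^sub>m 1\<^sub>m n"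

text \<open>
This is irreducibility in the form that the constructions below transport directly.
\<close>

definition trivial_commutant :: "nat \<Rightarrow> (gen \<Rightarrow> complex mat) \<Rightarrow> bool" where
  "trivial_commutant n P \<longleftrightarrow>
     (\<forall>X \<in> carrier_mat n n. (\<forall>g. X * P g = P g * X) \<longrightarrow> (\<exists>z. X = z \<cdot>\<^sub>m 1\<^sub>m n))"

lemma projection_systemD:
  assumes "projection_system w \<gamma> n P"
  shows "P g \<in> carrier_mat n n" "dim_row (P g) = n" "dim_col (P g) = n" "(P g)\<^sup>\<dagger> = P g" "P g * P g = P g"
    "P g * P (partner g) = 0\<^sub>m n n" "gsum n n (\<lambda>g. of_real (w g) \<cdot>\<^sub>m P g) = of_real \<gamma> \<cdot>\<^sub>m 1\<^sub>m n"
    "hermitian_idempotent n (P g)"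
proof -
  show c: "P g \<in> carrier_mat n n"
    using assms unfolding projection_system_def hermitian_idempotent_def by blast
  show "dim_row (P g) = n" "dim_col (P g) = n"
    using c by (rule carrier_matD)+
qed (use assms in \<open>unfold projection_system_def hermitian_idempotent_def, blast+\<close>)

lemma projection_system_trace:
  assumes "projection_system w \<gamma> n P"
  shows "(\<Sum>g\<in>UNIV. of_real (w g) * tr (P g)) = of_real \<gamma> * of_nat n"
proof -
  note [simp] = projection_systemD[OF assms]
  have "(\<Sum>g\<in>UNIV. of_real (w g) * tr (P g)) = tr (gsum n n (\<lambda>g. of_real (w g) \<cdot>\<^sub>m P g))"
    by (simp add: tr_gsum tr_smult del: projection_systemD(7)[OF assms])
  then show ?thesis by (simp add: tr_smult)
qed

text \<open>
Multiplying the scalar combination by \<open>P g\<close> and taking traces gives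
\<open>\<Sum> w k \<parallel>P k P g\<parallel>\<^sup>2 = \<gamma> \<parallel>P g\<parallel>\<^sup>2\<close> in the Frobenius norm. The other terms are
nonnegative, so the term \<open>k = g\<close> shows \<open>w g \<le> \<gamma>\<close>. In case of equality all other \<open>P k\<close> are orthogonal to \<open>P g\<close>, so that \<open>P g\<close> commutes
with the system and is a scalar; this is impossible beside another nonzero projection.
\<close>

theorem weight_less_total:
  assumes sys: "projection_system w \<gamma> n P" and triv: "trivial_commutant n P"
    and pos: "\<And>h. P h \<noteq> 0\<^sub>m n n \<Longrightarrow> 0 < w h"
    and g: "P g \<noteq> 0\<^sub>m n n" and h: "h \<noteq> g" "P h \<noteq> 0\<^sub>m n n"
  shows "w g < \<gamma>"
proof (rule ccontr)
  assume "\<not> w g < \<gamma>"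
  note P = projection_systemD[OF sys]
  note [simp] = P(1-4)
  have PP [simp]: "P k * P l \<in> carrier_mat n n" for k l
    by (rule mult_carrier_mat[OF P(1) P(1)])
  \<comment> \<open>the squared Frobenius norm of \<open>P k P g\<close>, which equals \<open>tr (P k P g)\<close>\<close>
  define t where "t k = (\<Sum>i<n. \<Sum>j<n. (cmod ((P k * P g) $$ (j, i)))\<^sup>2)" for k
  have t: "tr (P k * P g) = of_real (t k)" for k
  proof -
    have "(P k * P g)\<^sup>\<dagger> * (P k * P g) = P g * ((P k * P k) * P g)"
      by (simp add: adjoint_mult mat_mult_assoc)
    then have "(P k * P g)\<^sup>\<dagger> * (P k * P g) = P g * (P k * P g)" by (simp add: P(5))
    moreover have "tr (P g * (P k * P g)) = tr ((P k * P g) * P g)"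
      by (rule tr_mult_commute) simp_all
    moreover have "(P k * P g) * P g = P k * P g"
      by (simp add: mat_mult_assoc P(5) del: assoc_mult_mat)
    ultimately show ?thesis using tr_adjoint_mult[of "P k * P g"] by (simp add: t_def)
  qed
  have t_nonneg: "t k \<ge> 0" for k unfolding t_def by (intro sum_nonneg) auto
  have t_zero: "P k * P g = 0\<^sub>m n n" if "t k = 0" for k
    using that by (intro eq_matI) (auto simp: t_def sum_nonneg_eq_0_iff sum_nonneg simp del: index_mult_mat(1))
  have "gsum n n (\<lambda>k. of_real (w k) \<cdot>\<^sub>m (P k * P g)) = of_real \<gamma> \<cdot>\<^sub>m P g"
    using arg_cong[OF P(7), of "\<lambda>A. A * P g"] by (simp add: gsum_mult mat_smult_mult smult_one_mult)
  from arg_cong[OF this, of tr] have "(\<Sum>k\<in>UNIV. of_real (w k * t k)) = (of_real (\<gamma> * t g) :: complex)"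
    using t[of g] by (simp add: tr_gsum tr_smult t P(5))
  then have "(\<Sum>k\<in>UNIV. w k * t k) = \<gamma> * t g"
    by (simp only: of_real_eq_iff flip: of_real_sum)
  then have "(\<Sum>k\<in>UNIV - {g}. w k * t k) = (\<gamma> - w g) * t g"
    by (simp add: sum.remove[of UNIV g] algebra_simps)
  also have "\<dots> \<le> 0"
    using \<open>\<not> w g < \<gamma>\<close> t_nonneg[of g] by (simp add: mult_nonpos_nonneg)
  finally have le: "(\<Sum>k\<in>UNIV - {g}. w k * t k) \<le> 0" .
  have t0: "t k = 0" if "P k = 0\<^sub>m n n" for k
  proof -
    have "P k * P g = 0\<^sub>m n n" using that by simp
    then show ?thesis by (simp add: t_def del: index_mult_mat(1))
  qed
  have nonneg: "w k * t k \<ge> 0" for k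
    using pos[of k] t_nonneg[of k] t0[of k] by (cases "P k = 0\<^sub>m n n") auto
  have "w k * t k = 0" if "k \<noteq> g" for k
    using le nonneg sum_nonneg_eq_0_iff[of "UNIV - {g}" "\<lambda>k. w k * t k"] that
    by (simp add: order_antisym sum_nonneg)
  then have "t k = 0" if "k \<noteq> g" for k
    using that pos[of k] t0[of k] by force
  then have orth: "P k * P g = 0\<^sub>m n n" if "k \<noteq> g" for k using t_zero that by simp
  have "P g * P k = P k * P g" for k
  proof (cases "k = g")
    case False
    have "P g * P k = (P k * P g)\<^sup>\<dagger>" by (simp add: adjoint_mult)
    then show ?thesis using orth[OF False] by simp
  qed simp
  then obtain z where z: "P g = z \<cdot>\<^sub>m 1\<^sub>m n"
    using triv[unfolded trivial_commutant_def, rule_format, OF P(1)] by blast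
  have "z \<cdot>\<^sub>m P h = P h * P g"
    unfolding z by (rule smult_one_mult(2)[OF P(1), symmetric])
  also have "\<dots> = 0\<^sub>m n n" using h(1) by (rule orth)
  finally have zP: "z \<cdot>\<^sub>m P h = 0\<^sub>m n n" .
  have zero: "z * P h $$ (i, j) = 0" if "i < n" "j < n" for i j
    using arg_cong[OF zP, of "\<lambda>A. A $$ (i, j)"] that by simp
  have "z = 0"
  proof (rule ccontr)
    assume "z \<noteq> 0"
    then have "P h = 0\<^sub>m n n" using zero by (intro eq_matI) auto
    with h(2) show False by simp
  qed
  moreover have "0 \<cdot>\<^sub>m 1\<^sub>m n = (0\<^sub>m n n :: complex mat)" by (intro eq_matI) auto
  ultimately have "P g = 0\<^sub>m n n" using z by (simp only:)
  with g show False by simp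
qed

section \<open>The complementary system\<close>

fun gen_index :: "gen \<Rightarrow> nat" where
  "gen_index P1 = 0" | "gen_index P2 = 1" | "gen_index Q1 = 2" | "gen_index Q2 = 3"
| "gen_index S1 = 4" | "gen_index S2 = 5"

lemma gen_index_less: "gen_index g < 6"
  by (cases g) auto

lemma gen_index_eq_iff: "gen_index g = gen_index h \<longleftrightarrow> g = h"
  by (cases g; cases h) auto

text \<open>
Six copies of \<open>\<complex>\<^sup>n\<close> inside their orthogonal sum.
\<close>

lemma orthogonal_embeddings:
  obtains J :: "gen \<Rightarrow> complex mat" where
    "\<And>g. J g \<in> carrier_mat (6 * n) n"
    "\<And>g h. (J h)\<^sup>\<dagger> * J g = (if g = h then 1\<^sub>m n else 0\<^sub>m n n)"
proof -
  define J :: "gen \<Rightarrow> complex mat" where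
    "J g = mat (6 * n) n (\<lambda>(i, j). if i = gen_index g * n + j then 1 else 0)" for g
  have less: "gen_index g * n + j < 6 * n" if "j < n" for g j
  proof -
    have "gen_index g * n + j < (gen_index g + 1) * n" using that by simp
    also have "\<dots> \<le> 6 * n" using gen_index_less[of g] by (intro mult_right_mono) auto
    finally show ?thesis .
  qed
  have eq_iff: "gen_index g * n + i = gen_index h * n + j \<longleftrightarrow> g = h \<and> i = j" if "i < n" "j < n" for g h i j
  proof
    assume eq: "gen_index g * n + i = gen_index h * n + j"
    have "gen_index g = (gen_index g * n + i) div n" "gen_index h = (gen_index h * n + j) div n"
      using that by auto
    then show "g = h \<and> i = j" using eq gen_index_eq_iff by simp
  qed auto
  have "(J h)\<^sup>\<dagger> * J g = (if g = h then 1\<^sub>m n else 0\<^sub>m n n)" for g h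
  proof (rule eq_matI)
    fix i j assume "i < dim_row (if g = h then 1\<^sub>m n else 0\<^sub>m n n :: complex mat)"
      "j < dim_col (if g = h then 1\<^sub>m n else 0\<^sub>m n n :: complex mat)"
    then have ij: "i < n" "j < n" by (auto split: if_splits)
    then have "((J h)\<^sup>\<dagger> * J g) $$ (i, j) = (\<Sum>k<6 * n. cnj (J h $$ (k, i)) * J g $$ (k, j))"
      by (subst mult_index) (simp_all add: J_def)
    also have "\<dots> =
        (\<Sum>k<6 * n. if k = gen_index g * n + j then (if k = gen_index h * n + i then 1 else 0) else 0)"
      using ij by (intro sum.cong) (simp_all add: J_def)
    also have "\<dots> = (if gen_index g * n + j = gen_index h * n + i then 1 else 0)"
      using less[OF ij(2), of g] by simp
    finally show "((J h)\<^sup>\<dagger> * J g) $$ (i, j) = (if g = h then 1\<^sub>m n else 0\<^sub>m n n) $$ (i, j)"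
      using ij by (auto simp: eq_iff)
  qed (auto simp: J_def)
  then show thesis using that[of J] by (simp add: J_def)
qed

text \<open>
\<open>C g\<close> maps the \<open>g\<close>-th copy of \<open>\<complex>\<^sup>n\<close> to \<open>\<complex>\<^sup>n\<close> by \<open>P g\<close>, \<open>E\<close> is the projection onto the sum
of the ranges inside \<open>\<complex>\<^sup>6\<^sup>n\<close>, and \<open>\<Gamma> = \<Sum> s g C g\<close> satisfies \<open>\<Gamma> \<Gamma>\<^sup>\<dagger> = \<gamma>\<close>. So
\<open>G = \<Gamma>\<^sup>\<dagger> \<Gamma> / \<gamma>\<close> is a projection below \<open>E\<close>, and \<open>W g\<close> is the restriction to the \<open>g\<close>-th
range of the projection onto the complement \<open>E - G\<close>, written in coordinates of that complement. The
conclusion contains everything that is used about it: the inner products between the \<open>W g\<close> are those of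
the ranges minus the part that comes from \<open>G\<close>. Working with all of \<open>\<complex>\<^sup>n\<close> in each copy avoids a choice of bases.
\<close>

lemma complementary_frame:
  assumes sys: "projection_system w \<gamma> n P" and pos: "0 < \<gamma>"
    and s: "\<And>g. of_real (s g * s g) \<cdot>\<^sub>m P g = of_real (w g) \<cdot>\<^sub>m P g"
  obtains W :: "gen \<Rightarrow> complex mat" and m where
    "\<And>g. W g \<in> carrier_mat m n"
    "\<And>g. W g * P g = W g"
    "gsum m m (\<lambda>g. W g * (W g)\<^sup>\<dagger>) = 1\<^sub>m m"
    "\<And>g h. (W h)\<^sup>\<dagger> * W g = (if g = h then P g else 0\<^sub>m n n) - of_real (s h * s g / \<gamma>) \<cdot>\<^sub>m (P h * P g)"
    "of_nat m = (\<Sum>g\<in>UNIV. tr (P g)) - of_nat n"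
proof -
  note P = projection_systemD[OF sys]
  note [simp] = P(1-4)
  obtain J :: "gen \<Rightarrow> complex mat" where J [simp]: "\<And>g. J g \<in> carrier_mat (6 * n) n"
    and JJ: "\<And>g h. (J h)\<^sup>\<dagger> * J g = (if g = h then 1\<^sub>m n else 0\<^sub>m n n)"
    using orthogonal_embeddings[of n] by blast
  define N where "N = 6 * n"
  have [simp]: "dim_row (J g) = N" "dim_col (J g) = n" for g using carrier_matD[OF J[of g]] by (simp_all add: N_def)
  define C where "C g = P g * (J g)\<^sup>\<dagger>" for g
  have C [simp]: "dim_row (C g) = n" "dim_col (C g) = N" for g by (simp_all add: C_def)
  have Cc [simp]: "C g \<in> carrier_mat n N" "(C g)\<^sup>\<dagger> \<in> carrier_mat N n" for g
    by (intro carrier_matI; simp)+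
  have CC: "C h * (C g)\<^sup>\<dagger> = (if g = h then P g else 0\<^sub>m n n)" for g h
  proof -
    have "C h * (C g)\<^sup>\<dagger> = P h * (((J h)\<^sup>\<dagger> * J g) * P g)"
      by (simp add: C_def adjoint_mult mat_mult_assoc)
    then show ?thesis by (simp add: JJ P(5))
  qed
  have PC: "P g * C g = C g" for g
    by (simp add: C_def P(5) flip: mat_mult_assoc)
  have CP: "(C g)\<^sup>\<dagger> * P g = (C g)\<^sup>\<dagger>" for g
    using arg_cong[OF PC[of g], of mat_adjoint] by (simp add: adjoint_mult)
  define \<Gamma> where "\<Gamma> = gsum n N (\<lambda>g. of_real (s g) \<cdot>\<^sub>m C g)"
  define E where "E = gsum N N (\<lambda>g. (C g)\<^sup>\<dagger> * C g)"
  have dims [simp]: "dim_row \<Gamma> = n" "dim_col \<Gamma> = N" "dim_row E = N" "dim_col E = N"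
    by (simp_all add: \<Gamma>_def E_def)
  have CCc [simp]: "(C g)\<^sup>\<dagger> * C g \<in> carrier_mat N N" for g
    by (intro carrier_matI; simp)
  have \<Gamma>C: "\<Gamma> * (C g)\<^sup>\<dagger> = of_real (s g) \<cdot>\<^sub>m P g" for g
  proof -
    have "\<Gamma> * (C g)\<^sup>\<dagger> = gsum n n (\<lambda>h. of_real (s h) \<cdot>\<^sub>m (C h * (C g)\<^sup>\<dagger>))"
      unfolding \<Gamma>_def by (subst gsum_mult) (simp_all add: mat_smult_mult)
    also have "\<dots> = of_real (s g) \<cdot>\<^sub>m (C g * (C g)\<^sup>\<dagger>)"
      by (rule gsum_delta) (auto simp: CC intro!: eq_matI)
    finally show ?thesis by (simp add: CC)
  qed
  have C\<Gamma>: "C g * \<Gamma>\<^sup>\<dagger> = of_real (s g) \<cdot>\<^sub>m P g" for g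
    using arg_cong[OF \<Gamma>C[of g], of mat_adjoint] by (simp add: adjoint_mult adjoint_smult)
  have \<Gamma>adj: "\<Gamma>\<^sup>\<dagger> = gsum N n (\<lambda>g. of_real (s g) \<cdot>\<^sub>m (C g)\<^sup>\<dagger>)"
    unfolding \<Gamma>_def by (subst adjoint_gsum) (simp_all add: adjoint_smult)
  have \<Gamma>\<Gamma>: "\<Gamma> * \<Gamma>\<^sup>\<dagger> = of_real \<gamma> \<cdot>\<^sub>m 1\<^sub>m n"
  proof -
    have "\<Gamma> * \<Gamma>\<^sup>\<dagger> = gsum n n (\<lambda>g. of_real (s g) \<cdot>\<^sub>m (\<Gamma> * (C g)\<^sup>\<dagger>))"
      unfolding \<Gamma>adj by (subst mult_gsum) (simp_all add: mat_mult_smult)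
    also have "\<dots> = gsum n n (\<lambda>g. of_real (w g) \<cdot>\<^sub>m P g)"
      by (simp add: \<Gamma>C smult_smult_mat flip: s)
    finally show ?thesis by (simp add: P(7))
  qed
  have EC: "E * (C g)\<^sup>\<dagger> = (C g)\<^sup>\<dagger>" for g
  proof -
    have "E * (C g)\<^sup>\<dagger> = gsum N n (\<lambda>h. (C h)\<^sup>\<dagger> * (C h * (C g)\<^sup>\<dagger>))"
      unfolding E_def by (subst gsum_mult) (simp_all add: mat_mult_assoc)
    also have "\<dots> = (C g)\<^sup>\<dagger> * (C g * (C g)\<^sup>\<dagger>)"
      by (rule gsum_delta) (auto simp: CC CP)
    finally show ?thesis by (simp add: CC CP)
  qed
  have Eadj: "E\<^sup>\<dagger> = E"
    unfolding E_def by (subst adjoint_gsum) (simp_all add: adjoint_mult)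
  have EE: "E * E = E"
  proof -
    have "E * E = gsum N N (\<lambda>g. (E * (C g)\<^sup>\<dagger>) * C g)"
      by (subst (2) E_def, subst mult_gsum) (simp_all add: mat_mult_assoc)
    also have "\<dots> = E" unfolding EC by (simp only: E_def)
    finally show ?thesis .
  qed
  have E\<Gamma>: "E * \<Gamma>\<^sup>\<dagger> = \<Gamma>\<^sup>\<dagger>"
  proof -
    have "E * \<Gamma>\<^sup>\<dagger> = gsum N n (\<lambda>g. of_real (s g) \<cdot>\<^sub>m (E * (C g)\<^sup>\<dagger>))"
      unfolding \<Gamma>adj by (subst mult_gsum) (simp_all add: mat_mult_smult)
    then show ?thesis by (simp add: EC \<Gamma>adj)
  qed
  have \<Gamma>E: "\<Gamma> * E = \<Gamma>"
    using arg_cong[OF E\<Gamma>, of mat_adjoint] by (simp add: adjoint_mult Eadj)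
  define G where "G = of_real (1 / \<gamma>) \<cdot>\<^sub>m (\<Gamma>\<^sup>\<dagger> * \<Gamma>)"
  define Q where "Q = E - G"
  have dimsQ [simp]: "dim_row Q = N" "dim_col Q = N" "dim_row G = N" "dim_col G = N" by (simp_all add: Q_def G_def)
  have EG: "E * G = G"
    by (simp add: G_def mat_mult_smult E\<Gamma> flip: mat_mult_assoc)
  have GE: "G * E = G"
    by (simp add: G_def mat_smult_mult \<Gamma>E mat_mult_assoc)
  have GG: "G * G = G"
  proof -
    have "G * G = of_real (1 / \<gamma> * (1 / \<gamma>)) \<cdot>\<^sub>m (\<Gamma>\<^sup>\<dagger> * ((\<Gamma> * \<Gamma>\<^sup>\<dagger>) * \<Gamma>))"
      by (simp add: G_def mat_smult_mult mat_mult_smult mat_mult_assoc smult_smult_mat)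
    also have "(\<Gamma> * \<Gamma>\<^sup>\<dagger>) * \<Gamma> = of_real \<gamma> \<cdot>\<^sub>m \<Gamma>"
      unfolding \<Gamma>\<Gamma> by (rule smult_one_mult) (intro carrier_matI; simp)
    also have "of_real (1 / \<gamma> * (1 / \<gamma>)) \<cdot>\<^sub>m (\<Gamma>\<^sup>\<dagger> * (of_real \<gamma> \<cdot>\<^sub>m \<Gamma>)) = G"
      using pos by (simp add: G_def mat_mult_smult smult_smult_mat)
    finally show ?thesis .
  qed
  have Gadj: "G\<^sup>\<dagger> = G"
    by (simp add: G_def adjoint_smult adjoint_mult)
  have QE: "Q * E = Q"
    by (simp add: Q_def mat_minus_mult EE GE)
  have GQ: "G * Q = 0\<^sub>m N N"
    by (simp add: Q_def mat_mult_minus GE GG) (auto intro!: eq_matI)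
  have EQ: "E * Q = Q"
    by (simp add: Q_def mat_mult_minus EE EG)
  have "Q * Q = E * Q - G * Q"
    by (subst Q_def, subst mat_minus_mult) simp_all
  also have "\<dots> = Q" by (simp add: EQ GQ) (auto intro!: eq_matI)
  finally have "hermitian_idempotent N Q"
    by (auto simp: hermitian_idempotent_def Q_def adjoint_minus Eadj Gadj intro!: carrier_matI)
  then obtain m V where V: "V \<in> carrier_mat m N" "V * V\<^sup>\<dagger> = 1\<^sub>m m" "V\<^sup>\<dagger> * V = Q" "tr Q = of_nat m"
    using hermitian_idempotent_factor by blast
  have dimsV [simp]: "dim_row V = m" "dim_col V = N" using V(1) by auto
  define W where "W g = V * (C g)\<^sup>\<dagger>" for g
  have dimsW [simp]: "dim_row (W g) = m" "dim_col (W g) = n" for g by (simp_all add: W_def)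
  have "W g \<in> carrier_mat m n" for g by (intro carrier_matI) simp_all
  moreover have "W g * P g = W g" for g
    by (simp add: W_def mat_mult_assoc CP)
  moreover have "gsum m m (\<lambda>g. W g * (W g)\<^sup>\<dagger>) = 1\<^sub>m m"
  proof -
    have "V * E = (V * V\<^sup>\<dagger>) * (V * E)"
      unfolding V(2) by (rule left_mult_one_mat[symmetric]) (intro carrier_matI; simp)
    also have "\<dots> = V * ((V\<^sup>\<dagger> * V) * E)" by (simp add: mat_mult_assoc del: assoc_mult_mat)
    also have "\<dots> = V * (V\<^sup>\<dagger> * V)" by (simp add: V(3) QE)
    also have "\<dots> = (V * V\<^sup>\<dagger>) * V" by (simp add: mat_mult_assoc)
    also have "\<dots> = V" using V(1) by (simp add: V(2))
    finally have VE: "V * E = V" .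
    have "gsum m m (\<lambda>g. W g * (W g)\<^sup>\<dagger>) = gsum m m (\<lambda>g. (V * ((C g)\<^sup>\<dagger> * C g)) * V\<^sup>\<dagger>)"
      by (simp add: W_def adjoint_mult mat_mult_assoc)
    also have "\<dots> = gsum m N (\<lambda>g. V * ((C g)\<^sup>\<dagger> * C g)) * V\<^sup>\<dagger>"
      by (subst gsum_mult) (auto intro!: carrier_matI)
    also have "gsum m N (\<lambda>g. V * ((C g)\<^sup>\<dagger> * C g)) = V * E"
      unfolding E_def by (subst mult_gsum) auto
    finally show ?thesis by (simp add: VE V(2))
  qed
  moreover have "(W h)\<^sup>\<dagger> * W g = (if g = h then P g else 0\<^sub>m n n) - of_real (s h * s g / \<gamma>) \<cdot>\<^sub>m (P h * P g)" for g h
  proof -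
    have "(W h)\<^sup>\<dagger> * W g = C h * ((V\<^sup>\<dagger> * V) * (C g)\<^sup>\<dagger>)"
      by (simp add: W_def adjoint_mult mat_mult_assoc)
    also have "\<dots> = C h * (E * (C g)\<^sup>\<dagger>) - C h * (G * (C g)\<^sup>\<dagger>)"
      by (simp add: V(3) Q_def mat_minus_mult mat_mult_minus)
    also have "C h * (G * (C g)\<^sup>\<dagger>) = of_real (1 / \<gamma>) \<cdot>\<^sub>m ((C h * \<Gamma>\<^sup>\<dagger>) * (\<Gamma> * (C g)\<^sup>\<dagger>))"
      by (simp add: G_def mat_smult_mult mat_mult_smult mat_mult_assoc)
    also have "\<dots> = of_real (s h * s g / \<gamma>) \<cdot>\<^sub>m (P h * P g)"
      by (simp add: C\<Gamma> \<Gamma>C mat_smult_mult mat_mult_smult smult_smult_mat mult.commute)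
    finally show ?thesis by (simp add: EC CC)
  qed
  moreover have "of_nat m = (\<Sum>g\<in>UNIV. tr (P g)) - of_nat n"
  proof -
    have "tr G = of_real (1 / \<gamma>) * tr (\<Gamma> * \<Gamma>\<^sup>\<dagger>)"
      using tr_mult_commute[of \<Gamma> "\<Gamma>\<^sup>\<dagger>"] by (simp add: G_def tr_smult)
    also have "\<dots> = of_nat n" using pos by (simp add: \<Gamma>\<Gamma> tr_smult)
    finally have "tr G = of_nat n" .
    moreover have "tr ((C g)\<^sup>\<dagger> * C g) = tr (P g)" for g
      using tr_mult_commute[of "C g" "(C g)\<^sup>\<dagger>"] by (simp add: CC)
    then have "tr E = (\<Sum>g\<in>UNIV. tr (P g))"
      unfolding E_def by (subst tr_gsum) simp_all
    ultimately show ?thesis using V(4) by (simp add: Q_def tr_minus)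
  qed
  ultimately show thesis
    by (rule that)
qed

text \<open>
The new projections are \<open>P' g = t g W g (W g)\<^sup>\<dagger>\<close> for the frame \<open>W\<close> of the preceding lemma. For
\<open>h = g\<close> the inner products of the frame are \<open>(1 - w g / \<gamma>) P g\<close>, which determines the factor \<open>t g\<close>
and the new weight; for partners they vanish, which keeps the pairs orthogonal.

If \<open>X\<close> commutes with all \<open>P' g\<close>, then it acts on the range of \<open>W g\<close> through some \<open>Y g\<close> on the
range of \<open>P g\<close>, that is \<open>W g Y g = X W g\<close>. Through the inner products of the frame the \<open>Y g\<close> intertwine
the products \<open>P h P g\<close> as well, and hence they come from one operator \<open>Z\<close> in the commutant of \<open>P\<close>.
This \<open>Z\<close> is a scalar, and so is \<open>X\<close>.
\<close>

theorem complementary_system: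
  assumes sys: "projection_system w \<gamma> n P" and triv: "trivial_commutant n P" and pos: "0 < \<gamma>"
    and w: "\<And>g. P g \<noteq> 0\<^sub>m n n \<Longrightarrow> 0 < w g" "\<And>g. P g \<noteq> 0\<^sub>m n n \<Longrightarrow> w g < \<gamma>"
  obtains m P' where "projection_system (\<lambda>g. \<gamma> - w g) \<gamma> m P'" "trivial_commutant m P'"
    "\<And>g. tr (P' g) = tr (P g)" "of_nat m = (\<Sum>g\<in>UNIV. tr (P g)) - of_nat n"
proof -
  note P = projection_systemD[OF sys]
  note [simp] = P(1-4)
  define s where "s g = (if P g = 0\<^sub>m n n then 0 else sqrt (w g))" for g
  have s: "of_real (s g * s g) \<cdot>\<^sub>m P g = of_real (w g) \<cdot>\<^sub>m P g" for g
    using w(1)[of g] by (cases "P g = 0\<^sub>m n n") (auto simp: s_def intro!: eq_matI simp flip: of_real_mult)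
  obtain W m where Wc [simp]: "\<And>g. W g \<in> carrier_mat m n"
    and WP: "\<And>g. W g * P g = W g"
    and WW: "gsum m m (\<lambda>g. W g * (W g)\<^sup>\<dagger>) = 1\<^sub>m m"
    and K: "\<And>g h. (W h)\<^sup>\<dagger> * W g = (if g = h then P g else 0\<^sub>m n n) - of_real (s h * s g / \<gamma>) \<cdot>\<^sub>m (P h * P g)"
    and m: "of_nat m = (\<Sum>g\<in>UNIV. tr (P g)) - of_nat n"
    by (rule complementary_frame[OF sys pos s], rule that; assumption)
  have dimW [simp]: "dim_row (W g) = m" "dim_col (W g) = n" for g using carrier_matD[OF Wc[of g]] by auto
  have PW: "P g * (W g)\<^sup>\<dagger> = (W g)\<^sup>\<dagger>" for g
    using arg_cong[OF WP[of g], of mat_adjoint] by (simp add: adjoint_mult)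
  have W0: "W g = 0\<^sub>m m n" if "P g = 0\<^sub>m n n" for g
    using WP[of g] that by simp
  \<comment> \<open>if \<open>P g = 0\<close>, the denominator may be \<open>0\<close> and \<open>t g\<close> its default value; then \<open>W g = 0\<close>\<close>
  define t where "t g = complex_of_real (\<gamma> / (\<gamma> - w g))" for g
  have tK: "t g \<cdot>\<^sub>m ((W g)\<^sup>\<dagger> * W g) = P g" for g
  proof (cases "P g = 0\<^sub>m n n")
    case True
    then show ?thesis using W0[OF True] by (auto intro!: eq_matI)
  next
    case False
    have "s g * s g = w g" using w(1)[OF False] False by (simp add: s_def)
    then have "(W g)\<^sup>\<dagger> * W g = P g - of_real (w g / \<gamma>) \<cdot>\<^sub>m P g"
      unfolding K by (simp add: P(5) del: of_real_mult)
    also have "\<dots> = of_real (1 - w g / \<gamma>) \<cdot>\<^sub>m P g"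
      by (auto intro!: eq_matI simp: algebra_simps)
    finally have "t g \<cdot>\<^sub>m ((W g)\<^sup>\<dagger> * W g) = of_real (\<gamma> / (\<gamma> - w g) * (1 - w g / \<gamma>)) \<cdot>\<^sub>m P g"
      by (simp add: t_def smult_smult_mat)
    also have "\<gamma> / (\<gamma> - w g) * (1 - w g / \<gamma>) = 1"
      using pos w(2)[OF False] by (simp add: field_simps)
    finally show ?thesis by (auto intro!: eq_matI)
  qed
  define P' where "P' g = t g \<cdot>\<^sub>m (W g * (W g)\<^sup>\<dagger>)" for g
  have dimP' [simp]: "dim_row (P' g) = m" "dim_col (P' g) = m" for g by (simp_all add: P'_def)
  have P'c [simp]: "P' g \<in> carrier_mat m m" for g by (intro carrier_matI) simp_all
  have tadj: "cnj (t g) = t g" for g by (simp add: t_def)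
  have P'W: "P' g * W g = W g" for g
  proof -
    have "P' g * W g = W g * (t g \<cdot>\<^sub>m ((W g)\<^sup>\<dagger> * W g))"
      by (simp add: P'_def mat_smult_mult mat_mult_smult mat_mult_assoc)
    then show ?thesis by (simp add: tK WP)
  qed
  have WP': "(W g)\<^sup>\<dagger> * P' g = (W g)\<^sup>\<dagger>" for g
    using arg_cong[OF P'W[of g], of mat_adjoint] by (simp add: adjoint_mult P'_def adjoint_smult tadj)
  have "P' g * P' g = P' g" for g
  proof -
    have "P' g * P' g = t g \<cdot>\<^sub>m ((P' g * W g) * (W g)\<^sup>\<dagger>)"
      by (subst (2) P'_def) (simp add: mat_mult_smult mat_mult_assoc)
    also have "\<dots> = P' g" unfolding P'W by (simp only: P'_def)
    finally show ?thesis .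
  qed
  then have herm: "hermitian_idempotent m (P' g)" for g
    by (simp add: hermitian_idempotent_def) (simp add: P'_def adjoint_smult adjoint_mult tadj)
  have orth: "P' h * P' (partner h) = 0\<^sub>m m m" for h
  proof -
    let ?g = "partner h"
    have "(W h)\<^sup>\<dagger> * W ?g = 0\<^sub>m n n"
      unfolding K P(6) by (auto intro!: eq_matI)
    moreover have "P' h * P' ?g = (t h * t ?g) \<cdot>\<^sub>m (W h * (((W h)\<^sup>\<dagger> * W ?g) * (W ?g)\<^sup>\<dagger>))"
      by (simp add: P'_def mat_smult_mult mat_mult_smult mat_mult_assoc smult_smult_mat mult.commute)
    moreover have "W h * (0\<^sub>m n n * (W ?g)\<^sup>\<dagger>) = 0\<^sub>m m m"
      using right_mult_zero_mat[OF Wc[of h]] left_mult_zero_mat[OF adjoint_carrier[OF Wc[of ?g]]] by simp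
    ultimately show ?thesis by (auto intro!: eq_matI)
  qed
  have WWt: "of_real (\<gamma> - w g) \<cdot>\<^sub>m P' g = of_real \<gamma> \<cdot>\<^sub>m (W g * (W g)\<^sup>\<dagger>)" for g
  proof (cases "P g = 0\<^sub>m n n")
    case True
    then show ?thesis using W0[OF True] by (auto simp: P'_def intro!: eq_matI)
  next
    case False
    have "(\<gamma> - w g) * (\<gamma> / (\<gamma> - w g)) = \<gamma>" using w(2)[OF False] by simp
    then show ?thesis by (simp add: P'_def t_def smult_smult_mat del: of_real_diff of_real_divide flip: of_real_mult)
  qed
  have WWc [simp]: "W g * (W g)\<^sup>\<dagger> \<in> carrier_mat m m" for g by (intro carrier_matI) simp_all
  have sum: "gsum m m (\<lambda>g. of_real (\<gamma> - w g) \<cdot>\<^sub>m P' g) = of_real \<gamma> \<cdot>\<^sub>m 1\<^sub>m m"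
    unfolding WWt by (subst smult_gsum[symmetric]) (simp_all add: WW)
  have tr: "tr (P' g) = tr (P g)" for g
  proof -
    have "tr (P' g) = t g * tr ((W g)\<^sup>\<dagger> * W g)"
      using tr_mult_commute[of "W g" "(W g)\<^sup>\<dagger>"] by (simp add: P'_def tr_smult)
    also have "\<dots> = tr (t g \<cdot>\<^sub>m ((W g)\<^sup>\<dagger> * W g))" by (simp add: tr_smult)
    finally show ?thesis by (simp only: tK)
  qed
  have triv': "trivial_commutant m P'"
    unfolding trivial_commutant_def
  proof (intro ballI impI)
    fix X :: "complex mat" assume Xc [simp]: "X \<in> carrier_mat m m" and X: "\<forall>g. X * P' g = P' g * X"
    have dimX [simp]: "dim_row X = m" "dim_col X = m" using carrier_matD[OF Xc] by simp_all
    define Y where "Y g = t g \<cdot>\<^sub>m ((W g)\<^sup>\<dagger> * (X * W g))" for g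
    have dimY [simp]: "dim_row (Y g) = n" "dim_col (Y g) = n" for g by (simp_all add: Y_def)
    have Yc [simp]: "Y g \<in> carrier_mat n n" for g by (intro carrier_matI) simp_all
    have WY: "W g * Y g = X * W g" for g
    proof -
      have "W g * Y g = (P' g * X) * W g"
        by (simp add: Y_def P'_def mat_smult_mult mat_mult_smult mat_mult_assoc)
      also have "\<dots> = X * (P' g * W g)" by (simp add: mat_mult_assoc flip: X[rule_format])
      finally show ?thesis by (simp add: P'W)
    qed
    have YW: "Y g * (W g)\<^sup>\<dagger> = (W g)\<^sup>\<dagger> * X" for g
    proof -
      have "Y g * (W g)\<^sup>\<dagger> = (W g)\<^sup>\<dagger> * (X * P' g)"
        by (simp add: Y_def P'_def mat_smult_mult mat_mult_smult mat_mult_assoc)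
      also have "\<dots> = ((W g)\<^sup>\<dagger> * P' g) * X" by (simp add: mat_mult_assoc X[rule_format])
      finally show ?thesis by (simp add: WP')
    qed
    have PY: "P g * Y g = Y g" for g
    proof -
      have "P g * Y g = t g \<cdot>\<^sub>m ((P g * (W g)\<^sup>\<dagger>) * (X * W g))"
        by (simp add: Y_def mat_mult_smult mat_mult_assoc)
      then show ?thesis by (simp add: PW Y_def)
    qed
    have YP: "Y g * P g = Y g" for g
      by (simp add: Y_def mat_smult_mult mat_mult_assoc WP)
    have KY: "((W h)\<^sup>\<dagger> * W g) * Y g = Y h * ((W h)\<^sup>\<dagger> * W g)" for g h
    proof -
      have "((W h)\<^sup>\<dagger> * W g) * Y g = (W h)\<^sup>\<dagger> * (W g * Y g)" by (simp add: mat_mult_assoc)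
      also have "\<dots> = ((W h)\<^sup>\<dagger> * X) * W g" by (simp add: WY mat_mult_assoc)
      also have "\<dots> = Y h * ((W h)\<^sup>\<dagger> * W g)" by (simp add: YW[symmetric] mat_mult_assoc)
      finally show ?thesis .
    qed
    have Y0: "Y g = 0\<^sub>m n n" if "P g = 0\<^sub>m n n" for g
      using PY[of g] that by simp
    \<comment> \<open>the off-diagonal inner products are nonzero multiples of \<open>P h P g\<close>, so they can be cancelled\<close>
    have swap: "P h * Y g = Y h * P g" for g h
    proof (cases "g = h \<or> P g = 0\<^sub>m n n \<or> P h = 0\<^sub>m n n")
      case True
      then show ?thesis using PY[of g] YP[of g] Y0[of g] Y0[of h] by auto
    next
      case False
      define c where "c = complex_of_real (s h * s g / \<gamma>)"
      have c: "c \<noteq> 0" using False w(1)[of g] w(1)[of h] pos by (auto simp: c_def s_def)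
      have K': "(W h)\<^sup>\<dagger> * W g = (- c) \<cdot>\<^sub>m (P h * P g)"
        using False unfolding K c_def[symmetric] by (auto intro!: eq_matI)
      have "(- c) \<cdot>\<^sub>m (P h * Y g) = (- c) \<cdot>\<^sub>m (Y h * P g)"
      proof -
        have "(- c) \<cdot>\<^sub>m (P h * (P g * Y g)) = (- c) \<cdot>\<^sub>m ((Y h * P h) * P g)"
          using KY[of h g] unfolding K' by (simp add: mat_smult_mult mat_mult_smult mat_mult_assoc)
        then show ?thesis by (simp only: PY YP)
      qed
      from arg_cong[OF this, of "\<lambda>A. (- 1 / c) \<cdot>\<^sub>m A"] show ?thesis
        using c by (simp add: smult_smult_mat)
    qed
    \<comment> \<open>by \<open>Y g = Z P g\<close> and the scalar combination of the \<open>P g\<close>, this is the only candidate\<close>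
    define Z where "Z = of_real (1 / \<gamma>) \<cdot>\<^sub>m gsum n n (\<lambda>g. of_real (w g) \<cdot>\<^sub>m Y g)"
    have Zc: "Z \<in> carrier_mat n n" by (simp add: Z_def)
    have scale: "of_real (1 / \<gamma>) \<cdot>\<^sub>m (of_real \<gamma> \<cdot>\<^sub>m A) = A" for A :: "complex mat"
      using pos by (simp add: smult_smult_mat)
    have ZP: "Z * P g = Y g" for g
    proof -
      have "Z * P g = of_real (1 / \<gamma>) \<cdot>\<^sub>m gsum n n (\<lambda>h. of_real (w h) \<cdot>\<^sub>m (P h * Y g))"
        unfolding Z_def swap by (simp add: mat_smult_mult gsum_mult)
      also have "gsum n n (\<lambda>h. of_real (w h) \<cdot>\<^sub>m (P h * Y g)) = gsum n n (\<lambda>h. of_real (w h) \<cdot>\<^sub>m P h) * Y g"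
        by (subst gsum_mult) (simp_all add: mat_smult_mult)
      also have "\<dots> = of_real \<gamma> \<cdot>\<^sub>m Y g" unfolding P(7) by (rule smult_one_mult[of _ n n]) simp
      finally show ?thesis by (simp only: scale)
    qed
    have PZ: "P g * Z = Y g" for g
    proof -
      have "P g * Z = of_real (1 / \<gamma>) \<cdot>\<^sub>m gsum n n (\<lambda>h. of_real (w h) \<cdot>\<^sub>m (Y g * P h))"
        unfolding Z_def swap[symmetric] by (simp add: mat_mult_smult mult_gsum[of _ n n])
      also have "gsum n n (\<lambda>h. of_real (w h) \<cdot>\<^sub>m (Y g * P h)) = Y g * gsum n n (\<lambda>h. of_real (w h) \<cdot>\<^sub>m P h)"
        by (subst mult_gsum[of _ n n]) (simp_all add: mat_mult_smult)
      also have "\<dots> = of_real \<gamma> \<cdot>\<^sub>m Y g" unfolding P(7) by (rule smult_one_mult[of _ n n]) simp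
      finally show ?thesis by (simp only: scale)
    qed
    obtain z where z: "Z = z \<cdot>\<^sub>m 1\<^sub>m n"
      using triv[unfolded trivial_commutant_def, rule_format, OF Zc] unfolding ZP PZ by blast
    have Yz: "Y g = z \<cdot>\<^sub>m P g" for g
      using ZP[of g] unfolding z by (subst (asm) smult_one_mult[of _ n n]) simp_all
    have XW: "X * W g = z \<cdot>\<^sub>m W g" for g
      unfolding WY[symmetric] Yz by (simp add: mat_mult_smult WP)
    have "X = X * gsum m m (\<lambda>g. W g * (W g)\<^sup>\<dagger>)" unfolding WW by simp
    also have "\<dots> = gsum m m (\<lambda>g. (X * W g) * (W g)\<^sup>\<dagger>)"
      by (subst mult_gsum[of _ m m]) (simp_all add: mat_mult_assoc)
    also have "\<dots> = z \<cdot>\<^sub>m gsum m m (\<lambda>g. W g * (W g)\<^sup>\<dagger>)"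
      unfolding XW by (subst smult_gsum) (simp_all add: mat_smult_mult)
    finally show "\<exists>z. X = z \<cdot>\<^sub>m 1\<^sub>m m" unfolding WW ..
  qed
  have "projection_system (\<lambda>g. \<gamma> - w g) \<gamma> m P'"
    unfolding projection_system_def by (intro conjI allI herm orth sum)
  then show thesis using triv' tr m by (rule that)
qed

section \<open>Reflections of characters and dimensions\<close>

text \<open>
For \<open>f = M_f \<chi>\<close> the weights are the entries of \<open>\<chi>\<close>, and for \<open>x\<close> with integral entries the ranks
are the first six entries of \<open>M_d x\<close>. Dimension vectors are real here, so that the same two reflections
act on them and on characters.
\<close>

fun weight :: "real vec \<Rightarrow> gen \<Rightarrow> real" where
  "weight f P1 = f $ 1" | "weight f P2 = f $ 1 - f $ 0"
| "weight f Q1 = f $ 3" | "weight f Q2 = f $ 3 - f $ 2"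
| "weight f S1 = f $ 5" | "weight f S2 = f $ 5 - f $ 4"

fun rank_at :: "real vec \<Rightarrow> gen \<Rightarrow> real" where
  "rank_at x P1 = x $ 1 - x $ 0" | "rank_at x P2 = x $ 0"
| "rank_at x Q1 = x $ 3 - x $ 2" | "rank_at x Q2 = x $ 2"
| "rank_at x S1 = x $ 5 - x $ 4" | "rank_at x S2 = x $ 4"

definition realizable :: "real vec \<Rightarrow> real vec \<Rightarrow> bool" where
  "realizable f x \<longleftrightarrow> (\<exists>n P. real n = x $ 6 \<and> projection_system (weight f) (f $ 6) n P \<and>
     trivial_commutant n P \<and> (\<forall>g. tr (P g) = of_real (rank_at x g)))"

declare vec_of_list_Cons [simp del]

lemma vec_of_list_7_index [simp]:
  "vec_of_list [a, b, c, d, e, f, g] $ 0 = a" "vec_of_list [a, b, c, d, e, f, g] $ 1 = b"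
  "vec_of_list [a, b, c, d, e, f, g] $ Suc 0 = b" "vec_of_list [a, b, c, d, e, f, g] $ 2 = c"
  "vec_of_list [a, b, c, d, e, f, g] $ 3 = d" "vec_of_list [a, b, c, d, e, f, g] $ 4 = e"
  "vec_of_list [a, b, c, d, e, f, g] $ 5 = f" "vec_of_list [a, b, c, d, e, f, g] $ 6 = g"
  by (simp_all add: vec_of_list_index)

lemma c_bullet_index [simp]:
  "c_bullet x $ 0 = - x $ 0 + x $ 1" "c_bullet x $ 1 = x $ 1" "c_bullet x $ Suc 0 = x $ 1"
  "c_bullet x $ 2 = - x $ 2 + x $ 3" "c_bullet x $ 3 = x $ 3"
  "c_bullet x $ 4 = - x $ 4 + x $ 5" "c_bullet x $ 5 = x $ 5"
  "c_bullet x $ 6 = - x $ 6 + x $ 1 + x $ 3 + x $ 5"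
  by (simp_all add: c_bullet_def)

lemma c_circ_index [simp]:
  "c_circ x $ 0 = x $ 0" "c_circ x $ 1 = - x $ 1 + x $ 0 + x $ 6" "c_circ x $ Suc 0 = - x $ 1 + x $ 0 + x $ 6"
  "c_circ x $ 2 = x $ 2" "c_circ x $ 3 = - x $ 3 + x $ 2 + x $ 6"
  "c_circ x $ 4 = x $ 4" "c_circ x $ 5 = - x $ 5 + x $ 4 + x $ 6" "c_circ x $ 6 = x $ 6"
  by (simp_all add: c_circ_def)

lemma dim_c_bullet [simp]: "dim_vec (c_bullet x) = 7"
  by (simp add: c_bullet_def)

lemma dim_c_circ [simp]: "dim_vec (c_circ x) = 7"
  by (simp add: c_circ_def)

lemma less_7_iff: "i < 7 \<longleftrightarrow> i \<in> {0, 1, 2, 3, 4, 5, 6}" for i :: nat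
  by auto

lemma vec_7_eqI:
  assumes "dim_vec x = 7" "dim_vec y = 7" "x $ 0 = y $ 0" "x $ 1 = y $ 1" "x $ 2 = y $ 2" "x $ 3 = y $ 3"
    "x $ 4 = y $ 4" "x $ 5 = y $ 5" "x $ 6 = y $ 6"
  shows "x = y"
  by (rule eq_vecI) (use assms in \<open>auto simp: less_7_iff\<close>)

lemma c_bullet_c_bullet: "dim_vec x = 7 \<Longrightarrow> c_bullet (c_bullet x) = x"
  by (rule vec_7_eqI) auto

lemma c_circ_c_circ: "dim_vec x = 7 \<Longrightarrow> c_circ (c_circ x) = x"
  by (rule vec_7_eqI) auto

lemma projection_system_partner:
  assumes "projection_system w \<gamma> n P"
  shows "projection_system (\<lambda>g. w (partner g)) \<gamma> n (\<lambda>g. P (partner g))"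
proof -
  note P = projection_systemD[OF assms]
  have "gsum n n (\<lambda>g. of_real (w (partner g)) \<cdot>\<^sub>m P (partner g)) = gsum n n (\<lambda>g. of_real (w g) \<cdot>\<^sub>m P g)"
    unfolding gsum_def by (subst sum_partner) (rule refl)
  moreover have "P (partner g) * P (partner (partner g)) = 0\<^sub>m n n" for g by (rule P(6))
  ultimately show ?thesis
    unfolding projection_system_def using P(7,8) by auto
qed

lemma trivial_commutant_partner:
  assumes "trivial_commutant n P"
  shows "trivial_commutant n (\<lambda>g. P (partner g))"
  unfolding trivial_commutant_def
proof (intro ballI impI)
  fix X :: "complex mat" assume Xc: "X \<in> carrier_mat n n" and X: "\<forall>g. X * P (partner g) = P (partner g) * X"
  have "X * P g = P g * X" for g using X[rule_format, of "partner g"] by simp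
  then show "\<exists>z. X = z \<cdot>\<^sub>m 1\<^sub>m n"
    by (intro assms[unfolded trivial_commutant_def, rule_format, OF Xc])
qed

text \<open>
In the complementary system the smaller weight of a pair becomes the larger one, so the names of the two
projections of each pair are exchanged. The bounds on the weights are demanded only where the rank is
nonzero: between \<open>d_3\<close> and \<open>d_4\<close> the weight of a vanishing projection can be negative.
\<close>

theorem realizable_c_bullet:
  assumes real: "realizable f x" and pos: "0 < f $ 6"
    and w: "\<And>g. rank_at x g \<noteq> 0 \<Longrightarrow> 0 < weight f g \<and> weight f g < f $ 6"
  shows "realizable (c_circ f) (c_bullet x)"
proof -
  obtain n P where n: "real n = x $ 6" and sys: "projection_system (weight f) (f $ 6) n P"
    and triv: "trivial_commutant n P" and tr: "\<And>g. tr (P g) = of_real (rank_at x g)"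
    using real unfolding realizable_def by blast
  have "rank_at x g \<noteq> 0" if "P g \<noteq> 0\<^sub>m n n" for g
    using that unfolding tr_hermitian_idempotent_eq_0_iff[OF projection_systemD(8)[OF sys, of g], symmetric] tr
    by simp
  then have w': "\<And>g. P g \<noteq> 0\<^sub>m n n \<Longrightarrow> 0 < weight f g" "\<And>g. P g \<noteq> 0\<^sub>m n n \<Longrightarrow> weight f g < f $ 6"
    using w by blast+
  obtain m P' where P': "projection_system (\<lambda>g. f $ 6 - weight f g) (f $ 6) m P'" "trivial_commutant m P'"
    "\<And>g. tr (P' g) = tr (P g)" "of_nat m = (\<Sum>g\<in>UNIV. tr (P g)) - of_nat n"
    by (rule complementary_system[OF sys triv pos w'], assumption, assumption, rule that; assumption)
  have wt: "f $ 6 - weight f (partner g) = weight (c_circ f) g" for g by (cases g) simp_all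
  have mult: "rank_at x (partner g) = rank_at (c_bullet x) g" for g by (cases g) simp_all
  have "complex_of_real (real m) = of_real (x $ 1 + x $ 3 + x $ 5 - x $ 6)"
    using P'(4) by (simp add: sum_gen tr algebra_simps flip: n)
  then have "real m = c_bullet x $ 6" unfolding of_real_eq_iff by simp
  moreover have "projection_system (weight (c_circ f)) (c_circ f $ 6) m (\<lambda>g. P' (partner g))"
    using projection_system_partner[OF P'(1)] by (simp add: wt)
  moreover have "tr (P' (partner g)) = of_real (rank_at (c_bullet x) g)" for g
    by (simp add: P'(3) tr mult)
  ultimately show ?thesis
    using trivial_commutant_partner[OF P'(2)] unfolding realizable_def by blast
qed

text \<open>
With \<open>A = \<alpha>\<^sub>1 P\<^sub>1 + \<alpha>\<^sub>2 P\<^sub>2\<close> the new operator is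
\<open>\<alpha>\<^sub>1 - A = \<alpha>\<^sub>1 (1 - P\<^sub>1 - P\<^sub>2) + (\<alpha>\<^sub>1 - \<alpha>\<^sub>2) P\<^sub>2\<close>, and likewise in the other two branches.
\<close>

theorem realizable_c_circ:
  assumes real: "realizable f x"
  shows "realizable (c_bullet f) (c_circ x)"
proof -
  obtain n P where n: "real n = x $ 6" and sys: "projection_system (weight f) (f $ 6) n P"
    and triv: "trivial_commutant n P" and tr: "\<And>g. tr (P g) = of_real (rank_at x g)"
    using real unfolding realizable_def by blast
  note P = projection_systemD[OF sys]
  note [simp] = P(1-4)
  have orth': "P (partner g) * P g = 0\<^sub>m n n" for g using P(6)[of "partner g"] by simp
  define first where "first g \<longleftrightarrow> g \<in> {P1, Q1, S1}" for g
  define P' where "P' g = (if first g then 1\<^sub>m n - (P g + P (partner g)) else P g)" for g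
  have PP: "(P g + P (partner g)) * (P g + P (partner g)) = P g + P (partner g)" for g
    by (simp add: mat_add_mult mat_mult_add P(5,6) orth')
  have Sc [simp]: "P g + P (partner g) \<in> carrier_mat n n" for g by (intro carrier_matI) simp_all
  have idem: "hermitian_idempotent n (1\<^sub>m n - (P g + P (partner g)))" for g
  proof -
    have "(1\<^sub>m n - (P g + P (partner g))) * (1\<^sub>m n - (P g + P (partner g)))
        = (1\<^sub>m n - (P g + P (partner g))) - ((P g + P (partner g)) - (P g + P (partner g)))"
      by (simp add: mat_minus_mult mat_mult_minus PP)
    also have "\<dots> = 1\<^sub>m n - (P g + P (partner g))"
      by (rule eq_matI) simp_all
    finally show ?thesis
      by (simp add: hermitian_idempotent_def adjoint_minus adjoint_add minus_carrier_mat)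
  qed
  have PQ: "(1\<^sub>m n - (P g + P (partner g))) * P (partner g) = 0\<^sub>m n n"
       "P (partner g) * (1\<^sub>m n - (P g + P (partner g))) = 0\<^sub>m n n" for g
  proof -
    have "(1\<^sub>m n - (P g + P (partner g))) * P (partner g) = P (partner g) - (0\<^sub>m n n + P (partner g))"
      by (simp add: mat_add_mult mat_minus_mult P(5,6))
    also have "\<dots> = 0\<^sub>m n n" by (rule eq_matI) simp_all
    finally show "(1\<^sub>m n - (P g + P (partner g))) * P (partner g) = 0\<^sub>m n n" .
    have "P (partner g) * (1\<^sub>m n - (P g + P (partner g))) = P (partner g) - (0\<^sub>m n n + P (partner g))"
      by (simp add: mat_mult_add mat_mult_minus P(5) orth')
    also have "\<dots> = 0\<^sub>m n n" by (rule eq_matI) simp_all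
    finally show "P (partner g) * (1\<^sub>m n - (P g + P (partner g))) = 0\<^sub>m n n" .
  qed
  have first: "first (partner g) \<longleftrightarrow> \<not> first g" for g by (cases g) (auto simp: first_def)
  have orth: "P' g * P' (partner g) = 0\<^sub>m n n" for g
    using PQ(1)[of g] PQ(2)[of "partner g"] by (simp add: P'_def first)
  have dims [simp]: "dim_row (P' g) = n" "dim_col (P' g) = n" for g by (simp_all add: P'_def)
  have "gsum n n (\<lambda>g. of_real (weight (c_bullet f) g) \<cdot>\<^sub>m P' g) = of_real (c_bullet f $ 6) \<cdot>\<^sub>m 1\<^sub>m n"
  proof (rule eq_matI)
    fix i j assume "i < dim_row (of_real (c_bullet f $ 6) \<cdot>\<^sub>m (1\<^sub>m n :: complex mat))"
      "j < dim_col (of_real (c_bullet f $ 6) \<cdot>\<^sub>m (1\<^sub>m n :: complex mat))"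
    then have ij: "i < n" "j < n" by auto
    have "(\<Sum>g\<in>UNIV. of_real (weight f g) * P g $$ (i, j)) = of_real (f $ 6) * 1\<^sub>m n $$ (i, j)"
      using arg_cong[OF P(7), of "\<lambda>A. A $$ (i, j)"] ij by simp
    then show "gsum n n (\<lambda>g. of_real (weight (c_bullet f) g) \<cdot>\<^sub>m P' g) $$ (i, j)
        = (of_real (c_bullet f $ 6) \<cdot>\<^sub>m 1\<^sub>m n) $$ (i, j)"
      using ij by (simp add: sum_gen P'_def first_def algebra_simps)
  qed auto
  then have "projection_system (weight (c_bullet f)) (c_bullet f $ 6) n P'"
    unfolding projection_system_def by (intro conjI allI orth) (simp_all add: P'_def idem P(8))
  moreover have "trivial_commutant n P'"
    unfolding trivial_commutant_def
  proof (intro ballI impI)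
    fix X :: "complex mat" assume Xc: "X \<in> carrier_mat n n" and X: "\<forall>g. X * P' g = P' g * X"
    note [simp] = carrier_matD[OF Xc]
    have X2: "X * P g = P g * X" if "\<not> first g" for g
      using X[rule_format, of g] that by (simp add: P'_def)
    have "X * P g = P g * X" if "first g" for g
    proof -
      have "P g = 1\<^sub>m n - (P' g + P (partner g))"
        using that by (intro eq_matI) (auto simp: P'_def)
      moreover have "X * P (partner g) = P (partner g) * X"
        using that by (intro X2) (simp add: first)
      ultimately show ?thesis
        using X[rule_format, of g] Xc by (simp add: mat_minus_mult mat_mult_minus mat_add_mult mat_mult_add)
    qed
    then show "\<exists>z. X = z \<cdot>\<^sub>m 1\<^sub>m n"
      using triv[unfolded trivial_commutant_def, rule_format, OF Xc] X2 by blast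
  qed
  moreover have "tr (P' g) = of_real (rank_at (c_circ x) g)" for g
    by (cases g) (simp_all add: P'_def first_def tr_minus tr_add tr flip: n)
  ultimately show ?thesis
    unfolding realizable_def using n by (intro exI[of _ n] exI[of _ P']) simp
qed

lemma realizable_trace:
  assumes "realizable f x"
  shows "(\<Sum>g\<in>UNIV. weight f g * rank_at x g) = f $ 6 * x $ 6"
proof -
  obtain n P where n: "real n = x $ 6" and sys: "projection_system (weight f) (f $ 6) n P"
    and tr: "\<And>g. tr (P g) = of_real (rank_at x g)"
    using assms unfolding realizable_def by blast
  have "complex_of_real (\<Sum>g\<in>UNIV. weight f g * rank_at x g) = of_real (f $ 6 * x $ 6)"
    using projection_system_trace[OF sys] by (simp add: tr flip: n)
  then show ?thesis by (simp only: of_real_eq_iff)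
qed

lemma realizable_weight_less:
  assumes real: "realizable f x"
    and pos: "\<And>g. rank_at x g \<noteq> 0 \<Longrightarrow> 0 < weight f g"
    and g: "rank_at x g \<noteq> 0" and h: "h \<noteq> g" "rank_at x h \<noteq> 0"
  shows "weight f g < f $ 6"
proof -
  obtain n P where n: "real n = x $ 6" and sys: "projection_system (weight f) (f $ 6) n P"
    and triv: "trivial_commutant n P" and tr: "\<And>g. tr (P g) = of_real (rank_at x g)"
    using real unfolding realizable_def by blast
  have iff: "P k = 0\<^sub>m n n \<longleftrightarrow> rank_at x k = 0" for k
    unfolding tr_hermitian_idempotent_eq_0_iff[OF projection_systemD(8)[OF sys, of k], symmetric] tr by simp
  show ?thesis
    by (rule weight_less_total[OF sys triv _ _ h(1)], unfold iff) (use pos g h(2) in blast)+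
qed

section \<open>The sequence of dimension vectors\<close>

text \<open>
The vector \<open>d_k\<close>, as a real vector.
\<close>

definition dim_at :: "nat \<Rightarrow> real vec" where
  "dim_at k = map_vec real_of_int (d_vec k)"

lemma v_list_dim: "j < 6 \<Longrightarrow> dim_vec (v_list ! j) = 7"
  by (auto simp: v_list_def less_Suc_eq numeral_eq_Suc)

lemma delta_vec_index [simp]:
  "delta_vec $ 0 = 1" "delta_vec $ 1 = 2" "delta_vec $ Suc 0 = 2" "delta_vec $ 2 = 1" "delta_vec $ 3 = 2"
  "delta_vec $ 4 = 1" "delta_vec $ 5 = 2" "delta_vec $ 6 = 3" "dim_vec delta_vec = 7"
  by (simp_all add: delta_vec_def)

lemma dim_at_index:
  assumes "j < 6" "i < 7"
  shows "dim_at (6 * q + Suc j) $ i = real_of_int (v_list ! j $ i) + real q * real_of_int (delta_vec $ i)"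
proof -
  have "(6 * q + Suc j - 1) mod 6 = j" "(6 * q + Suc j - 1) div 6 = q" using assms by auto
  then have "d_vec (6 * q + Suc j) = v_list ! j + int q \<cdot>\<^sub>v delta_vec" by (simp add: d_vec_def)
  then show ?thesis using assms v_list_dim[of j] by (simp add: dim_at_def)
qed

lemma dim_dim_at [simp]: "dim_vec (dim_at k) = 7"
  by (simp add: dim_at_def d_vec_def)

lemma v_list_index:
  "v_list ! 0 = vec_of_list [0, 1, 0, 0, 0, 0, 0]" "v_list ! 1 = vec_of_list [1, 1, 0, 0, 0, 0, 1]"
  "v_list ! 2 = vec_of_list [1, 1, 0, 1, 0, 1, 1]" "v_list ! 3 = vec_of_list [0, 1, 1, 1, 1, 1, 2]"
  "v_list ! 4 = vec_of_list [0, 1, 1, 2, 1, 2, 2]" "v_list ! 5 = vec_of_list [1, 1, 1, 2, 1, 2, 3]"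
  by (simp_all add: v_list_def)

lemma less_6_cases: "j < 6 \<Longrightarrow> j = 0 \<or> j = 1 \<or> j = 2 \<or> j = 3 \<or> j = 4 \<or> j = (5::nat)"
  by auto

lemma dim_at_values:
  "dim_at (6 * q + 1) = vec_of_list [q, 1 + 2 * q, q, 2 * q, q, 2 * q, 3 * q]"
  "dim_at (6 * q + 2) = vec_of_list [1 + q, 1 + 2 * q, q, 2 * q, q, 2 * q, 1 + 3 * q]"
  "dim_at (6 * q + 3) = vec_of_list [1 + q, 1 + 2 * q, q, 1 + 2 * q, q, 1 + 2 * q, 1 + 3 * q]"
  "dim_at (6 * q + 4) = vec_of_list [q, 1 + 2 * q, 1 + q, 1 + 2 * q, 1 + q, 1 + 2 * q, 2 + 3 * q]"
  "dim_at (6 * q + 5) = vec_of_list [q, 1 + 2 * q, 1 + q, 2 + 2 * q, 1 + q, 2 + 2 * q, 2 + 3 * q]"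
  "dim_at (6 * q + 6) = vec_of_list [1 + q, 1 + 2 * q, 1 + q, 2 + 2 * q, 1 + q, 2 + 2 * q, 3 + 3 * q]"
  using dim_at_index[of 0 _ q] dim_at_index[of 1 _ q] dim_at_index[of 2 _ q] dim_at_index[of 3 _ q]
    dim_at_index[of 4 _ q] dim_at_index[of 5 _ q]
  by (auto intro!: vec_7_eqI simp: v_list_index[simplified])

lemma cases_mod_6:
  fixes k :: nat
  assumes "1 \<le> k"
  obtains q where "k = 6 * q + 1" | q where "k = 6 * q + 2" | q where "k = 6 * q + 3"
  | q where "k = 6 * q + 4" | q where "k = 6 * q + 5" | q where "k = 6 * q + 6"
proof -
  obtain q j where "k - 1 = 6 * q + j" "j < 6"
    using div_mod_decomp[of "k - 1" 6] by (metis mod_less_divisor mult.commute zero_less_numeral)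
  then have "k = 6 * q + Suc j" "j < 6" using assms by auto
  then show thesis using that less_6_cases[of j] by auto
qed

text \<open>
Each \<open>v\<^sub>r\<close> is the reflection of the preceding one, \<open>v\<^sub>6\<close> is followed by \<open>v\<^sub>1 + \<delta>\<close>, and
both reflections fix \<open>\<delta>\<close>.
\<close>

lemma dim_at_Suc:
  assumes "1 \<le> k"
  shows "dim_at (Suc k) = (if odd k then c_bullet (dim_at k) else c_circ (dim_at k))"
  using assms
proof (cases k rule: cases_mod_6)
  case (1 q)
  then have "Suc k = 6 * q + 2" by simp
  then show ?thesis unfolding \<open>Suc k = _\<close> unfolding 1 dim_at_values
    by (auto intro!: vec_7_eqI)
next
  case (2 q)
  then have "Suc k = 6 * q + 3" by simp
  then show ?thesis unfolding \<open>Suc k = _\<close> unfolding 2 dim_at_values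
    by (auto intro!: vec_7_eqI)
next
  case (3 q)
  then have "Suc k = 6 * q + 4" by simp
  then show ?thesis unfolding \<open>Suc k = _\<close> unfolding 3 dim_at_values
    by (auto intro!: vec_7_eqI)
next
  case (4 q)
  then have "Suc k = 6 * q + 5" by simp
  then show ?thesis unfolding \<open>Suc k = _\<close> unfolding 4 dim_at_values
    by (auto intro!: vec_7_eqI)
next
  case (5 q)
  then have "Suc k = 6 * q + 6" by simp
  then show ?thesis unfolding \<open>Suc k = _\<close> unfolding 5 dim_at_values
    by (auto intro!: vec_7_eqI)
next
  case (6 q)
  then have "Suc k = 6 * Suc q + 1" by simp
  then show ?thesis unfolding \<open>Suc k = _\<close> unfolding 6 dim_at_values
    by (auto intro!: vec_7_eqI)
qed

lemma rank_at_dim_at_pos: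
  assumes "7 \<le> k"
  shows "0 < rank_at (dim_at k) g"
proof -
  have "1 \<le> k" using assms by simp
  then show ?thesis
    by (cases k rule: cases_mod_6; cases g)
      (use assms in \<open>simp_all add: dim_at_values[simplified]\<close>)
qed

text \<open>
Together with the positivity of the ranks this is non-degeneracy. It fails for \<open>d_7\<close>, where
\<open>P\<^sub>1 + P\<^sub>2 = 1\<close>.
\<close>

lemma rank_at_less_dim_at:
  assumes "8 \<le> k"
  shows "rank_at (dim_at k) g + rank_at (dim_at k) (partner g) < dim_at k $ 6"
proof -
  have "1 \<le> k" using assms by simp
  then show ?thesis
    by (cases k rule: cases_mod_6; cases g)
      (use assms in \<open>simp_all add: dim_at_values[simplified]\<close>)
qed

section \<open>The sequence of characters\<close>

text \<open>
The character \<open>up i f\<close> belongs to \<open>d_(6+i)\<close> if \<open>f\<close> belongs to \<open>d_6\<close>: the character is changed by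
the reflection that is not applied to the dimension vector.
\<close>

primrec up :: "nat \<Rightarrow> real vec \<Rightarrow> real vec" where
  "up 0 f = f"
| "up (Suc i) f = (if even i then c_bullet (up i f) else c_circ (up i f))"

lemma dim_up [simp]: "dim_vec f = 7 \<Longrightarrow> dim_vec (up i f) = 7"
  by (induction i) auto

lemma up_double: "up (2 * s) f = (cox ^^ s) f"
  by (induction s) (simp_all add: cox_def)

lemma cox_cox_inv:
  assumes "dim_vec f = 7"
  shows "dim_vec ((cox_inv ^^ s) f) = 7" "(cox ^^ s) ((cox_inv ^^ s) f) = f"
proof -
  show dim: "dim_vec ((cox_inv ^^ s) f) = 7" for s
    using assms by (induction s) (simp_all add: cox_inv_def)
  show "(cox ^^ s) ((cox_inv ^^ s) f) = f"
  proof (induction s)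
    case (Suc s)
    have "cox (cox_inv v) = v" if "dim_vec v = 7" for v
      using that by (simp add: cox_def cox_inv_def c_bullet_c_bullet c_circ_c_circ)
    moreover have "(cox ^^ Suc s) ((cox_inv ^^ Suc s) f) = (cox ^^ s) (cox (cox_inv ((cox_inv ^^ s) f)))"
      unfolding funpow_Suc_right[of s cox] by simp
    ultimately show ?case using Suc dim[of s] by simp
  qed simp
qed

lemma dim_M_f [simp]: "dim_vec (M_f \<chi>) = 7"
  by (simp add: M_f_def)

text \<open>
The powers of \<open>c\<close> in the definition of \<open>D_k\<close> transport the character from \<open>d_k\<close> down to \<open>d_6\<close>.
\<close>

lemma D_map_eq:
  assumes "6 \<le> k"
  obtains f where "dim_vec f = 7" "D_map k \<chi> = D2 *\<^sub>v f" "up (k - 6) f = M_f \<chi>"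
proof -
  define s where "s = k div 2 - 3"
  define v where "v = (if even k then M_f \<chi> else c_bullet (M_f \<chi>))"
  have v: "dim_vec v = 7" by (simp add: v_def)
  have pow: "cox_pow (3 - int (k div 2)) = cox_inv ^^ s"
    using assms by (cases "k div 2 = 3") (auto simp: cox_pow_def s_def nat_diff_distrib)
  define f where "f = (cox_inv ^^ s) v"
  have "D_map k \<chi> = D2 *\<^sub>v f"
    by (simp add: D_map_def Let_def pow f_def v_def)
  moreover have up: "up (2 * s) f = v"
    unfolding up_double f_def by (rule cox_cox_inv(2)[OF v])
  have "up (k - 6) f = M_f \<chi>"
  proof (cases "even k")
    case True
    then have "k - 6 = 2 * s" using assms by (auto simp: s_def)
    then show ?thesis using up True by (simp add: v_def)
  next
    case False
    then have "k - 6 = Suc (2 * s)" using assms by (auto simp: s_def elim!: oddE)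
    then show ?thesis using up False by (simp add: v_def c_bullet_c_bullet)
  qed
  ultimately show thesis using that[of f] cox_cox_inv(1)[OF v] by (simp add: f_def)
qed

lemma D2_index:
  assumes "dim_vec f = 7"
  shows "(D2 *\<^sub>v f) $ 0 = f$2 - f$3 + f$4 - f$5 + f$6"
    "(D2 *\<^sub>v f) $ 1 = f$6 - f$3"
    "(D2 *\<^sub>v f) $ 2 = f$0 - f$1 - f$3 + f$4 - f$5 + 2 * f$6"
    "(D2 *\<^sub>v f) $ 3 = f$6 - f$5"
    "(D2 *\<^sub>v f) $ 4 = f$0 - f$1 + f$2 - f$3 - f$5 + 2 * f$6"
    "(D2 *\<^sub>v f) $ 5 = 2 * f$0 - f$1 + f$2 - 2 * f$3 + f$4 - 2 * f$5 + 3 * f$6"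
    "(D2 *\<^sub>v f) $ 6 = f$0 - f$1 + f$2 - 2 * f$3 + f$4 - 2 * f$5 + 3 * f$6"
  using assms
  by (simp_all add: D2_def mat_of_rows_list_def scalar_prod_def numeral_eq_Suc sum.atLeast_Suc_lessThan)

text \<open>
The conditions of the theorem, as inequalities for the character at \<open>d_6\<close>. The last line is the trace
identity at \<open>d_6\<close>; modulo it, the line before says that \<open>f $ 0\<close> is positive.
\<close>

definition chamber :: "real vec \<Rightarrow> bool" where
  "chamber f \<longleftrightarrow> 0 < f $ 2 - f $ 3 + f $ 4 - f $ 5 + f $ 6 \<and> 0 < f $ 6 - f $ 3 \<and>
     0 < f $ 0 - f $ 1 - f $ 3 + f $ 4 - f $ 5 + 2 * f $ 6 \<and> 0 < f $ 6 - f $ 5 \<and>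
     0 < f $ 0 - f $ 1 + f $ 2 - f $ 3 - f $ 5 + 2 * f $ 6 \<and>
     0 < 2 * f $ 0 - f $ 1 + f $ 2 - 2 * f $ 3 + f $ 4 - 2 * f $ 5 + 3 * f $ 6 \<and>
     f $ 0 - f $ 1 + f $ 2 - 2 * f $ 3 + f $ 4 - 2 * f $ 5 + 3 * f $ 6 = 0"

lemma less_6_iff: "i < 6 \<longleftrightarrow> i \<in> {0, 1, 2, 3, 4, 5}" for i :: nat
  by auto

lemma chamber_iff:
  assumes "dim_vec f = 7"
  shows "chamber f \<longleftrightarrow> (\<forall>i<6. 0 < (D2 *\<^sub>v f) $ i) \<and> (D2 *\<^sub>v f) $ 6 = 0"
  unfolding less_6_iff chamber_def ball_simps Ball_def[symmetric] D2_index[OF assms, symmetric]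
  by auto

text \<open>
The weights satisfy \<open>\<alpha>\<^sub>1 > \<alpha>\<^sub>2 > 0\<close> and likewise for the other two pairs.
\<close>

definition decreasing_weights :: "real vec \<Rightarrow> bool" where
  "decreasing_weights f \<longleftrightarrow> 0 < f $ 0 \<and> f $ 0 < f $ 1 \<and> 0 < f $ 2 \<and> f $ 2 < f $ 3 \<and> 0 < f $ 4 \<and> f $ 4 < f $ 5"

lemma all_gen: "(\<forall>g. Q g) \<longleftrightarrow> Q P1 \<and> Q P2 \<and> Q Q1 \<and> Q Q2 \<and> Q S1 \<and> Q S2"
  by (metis gen.exhaust)

lemma decreasing_weights_pos: "decreasing_weights f \<Longrightarrow> 0 < weight f g"
  by (cases g) (auto simp: decreasing_weights_def)

lemma decreasing_weights_c_bullet: "decreasing_weights f \<Longrightarrow> decreasing_weights (c_bullet f)"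
  by (auto simp: decreasing_weights_def)

text \<open>
The weight \<open>\<gamma> - w\<close> of the complementary system is positive exactly if \<open>w < \<gamma>\<close>, and the order of the
weights in a pair is kept because the names are exchanged. This links the hypotheses of
\<open>realizable_c_bullet\<close> to the shape of the next character.
\<close>

lemma decreasing_weights_c_circ:
  "decreasing_weights f \<Longrightarrow> decreasing_weights (c_circ f) \<longleftrightarrow> (\<forall>g. weight f g < f $ 6)"
  by (auto simp: decreasing_weights_def all_gen)


text \<open>
From \<open>d_8\<close> on every projection is nonzero, so the irreducible system itself guarantees that the weights
are smaller than \<open>\<gamma>\<close> before each complement is taken.
\<close>

lemma realizable_down:
  assumes f: "dim_vec f = 7"
  shows "realizable (up i f) (dim_at (6 + i)) \<Longrightarrow> decreasing_weights (up i f) \<Longrightarrow>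
    realizable f (dim_at 6) \<and> decreasing_weights f"
proof (induction i)
  case (Suc i)
  have dim: "dim_vec (up i f) = 7" using f by simp
  show ?case
  proof (cases "even i")
    case True
    then have u: "up (Suc i) f = c_bullet (up i f)" and d: "dim_at (6 + Suc i) = c_circ (dim_at (6 + i))"
      using dim_at_Suc[of "6 + i"] by simp_all
    have "realizable (up i f) (dim_at (6 + i))"
      using realizable_c_circ[OF Suc.prems(1)] dim by (simp only: u d c_bullet_c_bullet c_circ_c_circ dim_dim_at)
    moreover have "decreasing_weights (up i f)"
      using decreasing_weights_c_bullet[OF Suc.prems(2)] dim by (simp only: u c_bullet_c_bullet)
    ultimately show ?thesis by (rule Suc.IH)
  next
    case False
    then have u: "up (Suc i) f = c_circ (up i f)" and d: "dim_at (6 + Suc i) = c_bullet (dim_at (6 + i))"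
      using dim_at_Suc[of "6 + i"] by simp_all
    have rank: "rank_at (dim_at (6 + Suc i)) g \<noteq> 0" for g
      using rank_at_dim_at_pos[of "6 + Suc i" g] by simp
    have pos: "0 < weight (up (Suc i) f) g" for g
      by (rule decreasing_weights_pos[OF Suc.prems(2)])
    have less: "weight (up (Suc i) f) g < up (Suc i) f $ 6" for g
      by (rule realizable_weight_less[OF Suc.prems(1) pos rank _ rank, of "partner g"]) simp
    have "0 < up (Suc i) f $ 6" using pos[of P1] less[of P1] by linarith
    then have "realizable (up i f) (dim_at (6 + i))"
      using realizable_c_bullet[OF Suc.prems(1)] pos less dim
      by (simp only: u d c_bullet_c_bullet c_circ_c_circ dim_dim_at simp_thms)
    moreover have "decreasing_weights (c_circ (up (Suc i) f))"
      unfolding decreasing_weights_c_circ[OF Suc.prems(2)] using less by blast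
    then have "decreasing_weights (up i f)" using dim by (simp only: u c_circ_c_circ)
    ultimately show ?thesis by (rule Suc.IH)
  qed
qed simp

lemma dim_at_3_6:
  "dim_at 3 = vec_of_list [1, 1, 0, 1, 0, 1, 1]" "dim_at 4 = vec_of_list [0, 1, 1, 1, 1, 1, 2]"
  "dim_at 5 = vec_of_list [0, 1, 1, 2, 1, 2, 2]" "dim_at 6 = vec_of_list [1, 1, 1, 2, 1, 2, 3]"
  using dim_at_values[of 0] by simp_all

text \<open>
At \<open>d_6\<close> only \<open>P1\<close> vanishes, which gives the upper bounds for the weights at \<open>Q1\<close> and \<open>S1\<close>.
At \<open>d_4\<close> the system consists of three projections of rank one on \<open>\<complex>\<^sup>2\<close>; that each of their weights
is smaller than \<open>\<gamma>\<close> gives three more inequalities.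
\<close>

lemma chamber_of_realizable:
  assumes real: "realizable f (dim_at 6)" and dec: "decreasing_weights f"
  shows "chamber f"
proof -
  note pos = decreasing_weights_pos[OF dec]
  have less: "weight f g < f $ 6" if "g \<noteq> P1" for g
  proof -
    obtain h where "h \<noteq> g" "h \<noteq> P1" by (metis gen.distinct(11) gen.distinct(1,3))
    with that show ?thesis
      by (intro realizable_weight_less[OF real pos, of g h]) (cases g; cases h; simp add: dim_at_3_6)+
  qed
  have "0 < f $ 6" using pos[of P2] less[of P2] by simp
  moreover have "0 < weight f g \<and> weight f g < f $ 6" if "rank_at (dim_at 6) g \<noteq> 0" for g
    using pos[of g] less[of g] that by (cases g) (auto simp: dim_at_3_6)
  ultimately have "realizable (c_circ f) (c_bullet (dim_at 6))"
    by (rule realizable_c_bullet[OF real])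
  from realizable_c_circ[OF this]
  have real4: "realizable (c_bullet (c_circ f)) (dim_at 4)"
    using dim_at_Suc[of 5] dim_at_Suc[of 4] by (simp add: c_bullet_c_bullet c_circ_c_circ)
  have pos4: "0 < weight (c_bullet (c_circ f)) g" if "rank_at (dim_at 4) g \<noteq> 0" for g
    using that less[of P2] dec by (cases g) (auto simp: dim_at_3_6 decreasing_weights_def)
  have "weight (c_bullet (c_circ f)) P1 < c_bullet (c_circ f) $ 6"
    by (rule realizable_weight_less[OF real4 pos4, of _ Q2]) (simp_all add: dim_at_3_6)
  moreover have "weight (c_bullet (c_circ f)) Q2 < c_bullet (c_circ f) $ 6"
    by (rule realizable_weight_less[OF real4 pos4, of _ S2]) (simp_all add: dim_at_3_6)
  moreover have "weight (c_bullet (c_circ f)) S2 < c_bullet (c_circ f) $ 6"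
    by (rule realizable_weight_less[OF real4 pos4, of _ Q2]) (simp_all add: dim_at_3_6)
  ultimately show ?thesis
    using realizable_trace[OF real] less[of Q1] less[of S1] dec
    by (simp add: chamber_def decreasing_weights_def sum_gen dim_at_3_6)
qed

text \<open>
On a one-dimensional space with \<open>P2 = Q1 = S1 = 1\<close> the only condition is the sum of the three weights.
\<close>

lemma realizable_3:
  assumes "f $ 1 - f $ 0 + f $ 3 + f $ 5 = f $ 6"
  shows "realizable f (dim_at 3)"
proof -
  define P :: "gen \<Rightarrow> complex mat" where "P g = (if g \<in> {P2, Q1, S1} then 1\<^sub>m 1 else 0\<^sub>m 1 1)" for g
  have "complex_of_real (f $ 1 - f $ 0 + f $ 3 + f $ 5) = of_real (f $ 6)" using assms by simp
  then have "projection_system (weight f) (f $ 6) 1 P"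
    unfolding projection_system_def hermitian_idempotent_def all_gen
    by (auto simp: P_def sum_gen intro!: eq_matI)
  moreover have "trivial_commutant 1 P"
    unfolding trivial_commutant_def
  proof (intro ballI impI)
    fix X :: "complex mat" assume "X \<in> carrier_mat 1 1"
    then have "X = X $$ (0, 0) \<cdot>\<^sub>m 1\<^sub>m 1" by (intro eq_matI) auto
    then show "\<exists>z. X = z \<cdot>\<^sub>m 1\<^sub>m 1" ..
  qed
  moreover have "tr (P g) = of_real (rank_at (dim_at 3) g)" for g
    by (cases g) (simp_all add: P_def dim_at_3_6 tr_def)
  ultimately show ?thesis
    unfolding realizable_def by (intro exI[of _ 1] exI[of _ P]) (simp add: dim_at_3_6)
qed

lemma realizable_6_of_chamber:
  assumes f: "dim_vec f = 7" and ch: "chamber f"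
  shows "realizable f (dim_at 6)"
proof -
  define f3 where "f3 = c_circ (c_bullet (c_circ f))"
  have "realizable f3 (dim_at 3)"
    using ch by (intro realizable_3) (simp add: f3_def chamber_def)
  moreover have "0 < f3 $ 6" using ch by (simp add: f3_def chamber_def)
  moreover have "0 < weight f3 g \<and> weight f3 g < f3 $ 6" if "rank_at (dim_at 3) g \<noteq> 0" for g
    using that ch by (cases g) (simp_all add: dim_at_3_6 f3_def chamber_def)
  ultimately have "realizable (c_circ f3) (c_bullet (dim_at 3))"
    by (rule realizable_c_bullet)
  from realizable_c_circ[OF this]
  have real5: "realizable (c_circ f) (dim_at 5)"
    using f dim_at_Suc[of 3] dim_at_Suc[of 4] by (simp add: f3_def c_bullet_c_bullet c_circ_c_circ)
  moreover have "0 < c_circ f $ 6" using ch by (simp add: chamber_def)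
  moreover have "0 < weight (c_circ f) g \<and> weight (c_circ f) g < c_circ f $ 6" if "rank_at (dim_at 5) g \<noteq> 0" for g
    using that ch by (cases g) (simp_all add: dim_at_3_6 chamber_def)
  ultimately have "realizable (c_circ (c_circ f)) (c_bullet (dim_at 5))"
    by (rule realizable_c_bullet)
  then show ?thesis
    using f dim_at_Suc[of 5] by (simp add: c_circ_c_circ)
qed

lemma up_pos: "0 < i \<Longrightarrow> up i f = (if odd i then c_bullet (up (i - 1) f) else c_circ (up (i - 1) f))"
  by (cases i) auto

lemma up_add: "even j \<Longrightarrow> up (i + j) f = up i (up j f)"
  by (induction i) auto

definition delta_real :: "real vec" where
  "delta_real = vec_of_list [1, 2, 1, 2, 1, 2, 3]"

lemma delta_real_index [simp]:
  "delta_real $ 0 = 1" "delta_real $ 1 = 2" "delta_real $ Suc 0 = 2" "delta_real $ 2 = 1" "delta_real $ 3 = 2"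
  "delta_real $ 4 = 1" "delta_real $ 5 = 2" "delta_real $ 6 = 3" "dim_vec delta_real = 7"
  by (simp_all add: delta_real_def)

lemma up_add_delta:
  assumes "dim_vec f = 7"
  shows "up i (f + t \<cdot>\<^sub>v delta_real) = up i f + t \<cdot>\<^sub>v delta_real"
proof (induction i)
  case (Suc i)
  have "dim_vec (up i f) = 7" using assms by simp
  with Suc show ?case by (auto intro!: vec_7_eqI simp: algebra_simps)
qed simp

text \<open>
The numbers \<open>y1\<close> to \<open>y5\<close> are the first five entries of \<open>D2 f\<close>. Together with \<open>y6 = f $ 0\<close> they
are coordinates on the hyperplane of the trace identity, with the chamber as positive orthant. In these
coordinates all weights along the orbit and their differences within a pair are sums with nonnegative
coefficients.
\<close>

lemma orbit_from_chamber:
  assumes f: "dim_vec f = 7" and ch: "chamber f"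
  shows "i < 12 \<Longrightarrow> decreasing_weights (up i f)" "up 12 f = f + f $ 1 \<cdot>\<^sub>v delta_real" "0 < f $ 1"
proof -
  define y1 where "y1 = f $ 2 - f $ 3 + f $ 4 - f $ 5 + f $ 6"
  define y2 where "y2 = f $ 6 - f $ 3"
  define y3 where "y3 = f $ 0 - f $ 1 - f $ 3 + f $ 4 - f $ 5 + 2 * f $ 6"
  define y4 where "y4 = f $ 6 - f $ 5"
  define y5 where "y5 = f $ 0 - f $ 1 + f $ 2 - f $ 3 - f $ 5 + 2 * f $ 6"
  define y6 where "y6 = f $ 0"
  have y: "0 < y1" "0 < y2" "0 < y3" "0 < y4" "0 < y5" "0 < y6"
    using ch unfolding chamber_def y1_def y2_def y3_def y4_def y5_def y6_def by linarith+
  have u0: "f = vec_of_list [y6, y1 + y2 + y4 + y6, y1 + y5, y1 + y3 + y4 + y5, y1 + y3, y1 + y2 + y3 + y5,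
      y1 + y2 + y3 + y4 + y5]"
    using ch f unfolding chamber_def y1_def y2_def y3_def y4_def y5_def y6_def
    by (intro vec_7_eqI) (simp_all)
  have u1: "up (Suc 0) f =
        vec_of_list [y1 + y2 + y4, y1 + y2 + y4 + y6, y3 + y4, y1 + y3 + y4 + y5, y2 + y5, y1 + y2 + y3 +
      y5, 2 * y1 + y2 + y3 + y4 + y5 + y6]"
    by (rule vec_7_eqI) (simp_all add: up_pos, simp_all add: u0)
  have u2: "up 2 f =
        vec_of_list [y1 + y2 + y4, 2 * y1 + y2 + y3 + y4 + y5, y3 + y4, y1 + y2 + y3 + y4 + y6, y2 + y5,
      y1 + y2 + y4 + y5 + y6, 2 * y1 + y2 + y3 + y4 + y5 + y6]"
    by (rule vec_7_eqI) (simp_all add: up_pos, simp_all add: u0)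
  have u3: "up 3 f =
        vec_of_list [y1 + y3 + y5, 2 * y1 + y2 + y3 + y4 + y5, y1 + y2 + y6, y1 + y2 + y3 + y4 + y6, y1 +
      y4 + y6, y1 + y2 + y4 + y5 + y6, 2 * y1 + 2 * y2 + y3 + 2 * y4 + y5 + y6]"
    by (rule vec_7_eqI) (simp_all add: up_pos u2)
  have u4: "up 4 f =
        vec_of_list [y1 + y3 + y5, y1 + y2 + y3 + y4 + y5 + y6, y1 + y2 + y6, 2 * y1 + 2 * y2 + y4 + y5 +
      y6, y1 + y4 + y6, 2 * y1 + y2 + y3 + 2 * y4 + y6, 2 * y1 + 2 * y2 + y3 + 2 * y4 + y5 + y6]"
    by (rule vec_7_eqI) (simp_all add: up_pos u3)
  have u5: "up 5 f =
        vec_of_list [y2 + y4 + y6, y1 + y2 + y3 + y4 + y5 + y6, y1 + y2 + y4 + y5, 2 * y1 + 2 * y2 + y4 +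
      y5 + y6, y1 + y2 + y3 + y4, 2 * y1 + y2 + y3 + 2 * y4 + y6, 3 * y1 + 2 * y2 + y3 + 2 * y4 + y5 + 2
      * y6]"
    by (rule vec_7_eqI) (simp_all add: up_pos u4)
  have u6: "up 6 f =
        vec_of_list [y2 + y4 + y6, 2 * y1 + 2 * y2 + 2 * y4 + 2 * y6, y1 + y2 + y4 + y5, 2 * y1 + y2 + y3
      + 2 * y4 + y5 + y6, y1 + y2 + y3 + y4, 2 * y1 + 2 * y2 + y3 + y4 + y5 + y6, 3 * y1 + 2 * y2 + y3 +
      2 * y4 + y5 + 2 * y6]"
    by (rule vec_7_eqI) (simp_all add: up_pos u5)
  have u7: "up 7 f =
        vec_of_list [2 * y1 + y2 + y4 + y6, 2 * y1 + 2 * y2 + 2 * y4 + 2 * y6, y1 + y3 + y4 + y6, 2 * y1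
      + y2 + y3 + 2 * y4 + y5 + y6, y1 + y2 + y5 + y6, 2 * y1 + 2 * y2 + y3 + y4 + y5 + y6, 3 * y1 + 3 *
      y2 + y3 + 3 * y4 + y5 + 2 * y6]"
    by (rule vec_7_eqI) (simp_all add: up_pos u6)
  have u8: "up 8 f =
        vec_of_list [2 * y1 + y2 + y4 + y6, 3 * y1 + 2 * y2 + y3 + 2 * y4 + y5 + y6, y1 + y3 + y4 + y6, 2
      * y1 + 2 * y2 + y3 + 2 * y4 + 2 * y6, y1 + y2 + y5 + y6, 2 * y1 + 2 * y2 + 2 * y4 + y5 + 2 * y6, 3
      * y1 + 3 * y2 + y3 + 3 * y4 + y5 + 2 * y6]"
    by (rule vec_7_eqI) (simp_all add: up_pos u7)
  have u9: "up 9 f =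
        vec_of_list [y1 + y2 + y3 + y4 + y5, 3 * y1 + 2 * y2 + y3 + 2 * y4 + y5 + y6, y1 + 2 * y2 + y4 +
      y6, 2 * y1 + 2 * y2 + y3 + 2 * y4 + 2 * y6, y1 + y2 + 2 * y4 + y6, 2 * y1 + 2 * y2 + 2 * y4 + y5 +
      2 * y6, 4 * y1 + 3 * y2 + y3 + 3 * y4 + y5 + 3 * y6]"
    by (rule vec_7_eqI) (simp_all add: up_pos u8)
  have u10: "up 10 f =
        vec_of_list [y1 + y2 + y3 + y4 + y5, 2 * y1 + 2 * y2 + y3 + 2 * y4 + y5 + 2 * y6, y1 + 2 * y2 +
      y4 + y6, 3 * y1 + 3 * y2 + 2 * y4 + y5 + 2 * y6, y1 + y2 + 2 * y4 + y6, 3 * y1 + 2 * y2 + y3 + 3 *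
      y4 + 2 * y6, 4 * y1 + 3 * y2 + y3 + 3 * y4 + y5 + 3 * y6]"
    by (rule vec_7_eqI) (simp_all add: up_pos u9)
  have u11: "up 11 f =
        vec_of_list [y1 + y2 + y4 + 2 * y6, 2 * y1 + 2 * y2 + y3 + 2 * y4 + y5 + 2 * y6, 2 * y1 + y2 + y4
      + y5 + y6, 3 * y1 + 3 * y2 + 2 * y4 + y5 + 2 * y6, 2 * y1 + y2 + y3 + y4 + y6, 3 * y1 + 2 * y2 + y3
      + 3 * y4 + 2 * y6, 4 * y1 + 4 * y2 + y3 + 4 * y4 + y5 + 3 * y6]"
    by (rule vec_7_eqI) (simp_all add: up_pos u10)
  have u12: "up 12 f =
        vec_of_list [y1 + y2 + y4 + 2 * y6, 3 * y1 + 3 * y2 + 3 * y4 + 3 * y6, 2 * y1 + y2 + y4 + y5 +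
      y6, 3 * y1 + 2 * y2 + y3 + 3 * y4 + y5 + 2 * y6, 2 * y1 + y2 + y3 + y4 + y6, 3 * y1 + 3 * y2 + y3 +
      2 * y4 + y5 + 2 * y6, 4 * y1 + 4 * y2 + y3 + 4 * y4 + y5 + 3 * y6]"
    by (rule vec_7_eqI) (simp_all add: up_pos u11)
  show "up 12 f = f + f $ 1 \<cdot>\<^sub>v delta_real"
    by (rule vec_7_eqI) (simp_all add: u12, simp_all add: u0)
  show "0 < f $ 1" using y by (simp add: u0)
  assume "i < 12"
  then have "i = 0 \<or> i = 1 \<or> i = 2 \<or> i = 3 \<or> i = 4 \<or> i = 5 \<or> i = 6 \<or> i = 7 \<or> i = 8 \<or> i = 9 \<or>
    i = 10 \<or> i = 11" by presburger
  then show "decreasing_weights (up i f)"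
    by (elim disjE) (use y in \<open>simp_all add: decreasing_weights_def u1 u2 u3 u4 u5 u6 u7 u8 u9 u10 u11\<close>, simp_all add: u0)
qed

text \<open>
The multiple of \<open>\<delta>\<close> gained in twelve steps passes unchanged through all later steps, and adding it
preserves decreasing weights.
\<close>

lemma decreasing_weights_up:
  assumes f: "dim_vec f = 7" and ch: "chamber f"
  shows "decreasing_weights (up i f)"
proof (induction i rule: less_induct)
  case (less i)
  show ?case
  proof (cases "i < 12")
    case False
    define j where "j = i - 12"
    have "up i f = up (j + 12) f" using False by (simp add: j_def)
    also have "\<dots> = up j f + f $ 1 \<cdot>\<^sub>v delta_real"
      by (simp add: up_add orbit_from_chamber(2)[OF f ch] up_add_delta[OF f])
    finally have u: "up i f = up j f + f $ 1 \<cdot>\<^sub>v delta_real" .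
    have "decreasing_weights (up j f)" using False by (intro less) (simp add: j_def)
    moreover have "dim_vec (up j f) = 7" using f by simp
    ultimately show ?thesis using orbit_from_chamber(3)[OF f ch] unfolding u decreasing_weights_def
      by simp
  qed (rule orbit_from_chamber(1)[OF f ch])
qed

lemma realizable_up:
  assumes f: "dim_vec f = 7" and ch: "chamber f"
  shows "realizable (up i f) (dim_at (6 + i))"
proof (induction i)
  case 0
  then show ?case using realizable_6_of_chamber[OF f ch] by simp
next
  case (Suc i)
  show ?case
  proof (cases "even i")
    case True
    then show ?thesis using realizable_c_circ[OF Suc] dim_at_Suc[of "6 + i"] by simp
  next
    case False
    then have u: "up (Suc i) f = c_circ (up i f)" by simp
    note dec = decreasing_weights_up[OF f ch, of i]
    have "decreasing_weights (c_circ (up i f))"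
      using decreasing_weights_up[OF f ch, of "Suc i"] by (simp only: u)
    then have less: "weight (up i f) g < up i f $ 6" for g
      using decreasing_weights_c_circ[OF dec] by blast
    have pos: "0 < weight (up i f) g" for g using dec by (rule decreasing_weights_pos)
    have "0 < up i f $ 6" using less[of P1] pos[of P1] by linarith
    then have "realizable (c_circ (up i f)) (c_bullet (dim_at (6 + i)))"
      by (rule realizable_c_bullet[OF Suc]) (simp add: less pos)
    then show ?thesis using False dim_at_Suc[of "6 + i"] by simp
  qed
qed

theorem realizable_iff_D_map:
  assumes k: "8 \<le> k" and dec: "decreasing_weights (M_f \<chi>)"
  shows "realizable (M_f \<chi>) (dim_at k) \<longleftrightarrow> (\<forall>i<6. 0 < D_map k \<chi> $ i) \<and> D_map k \<chi> $ 6 = 0"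
proof -
  obtain f where f: "dim_vec f = 7" and D: "D_map k \<chi> = D2 *\<^sub>v f" and up: "up (k - 6) f = M_f \<chi>"
    using D_map_eq[of k \<chi>] k by auto
  have k': "6 + (k - 6) = k" using k by simp
  have "realizable (M_f \<chi>) (dim_at k) \<longleftrightarrow> chamber f"
    using realizable_down[OF f, of "k - 6"] realizable_up[OF f, of "k - 6"] chamber_of_realizable[of f] dec
    unfolding up k' by blast
  then show ?thesis unfolding D chamber_iff[OF f] .
qed

section \<open>Representations of the star-algebra\<close>

lemma free_alg_induct [case_names zero single add]:
  fixes x :: "'k \<Rightarrow>\<^sub>0 'v :: comm_monoid_add"
  assumes "Q 0" "\<And>w a. Q (Poly_Mapping.single w a)" "\<And>x y. Q x \<Longrightarrow> Q y \<Longrightarrow> Q (x + y)"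
  shows "Q x"
proof (induction x rule: update_induct)
  case const
  then show ?case using assms(1) unfolding zero_poly_mapping.abs_eq .
next
  case (update f a b)
  have "Poly_Mapping.update a b f = f + Poly_Mapping.single a b"
    using update(1)
    by (intro poly_mapping_eqI) (auto simp: lookup_update lookup_add lookup_single when_def in_keys_iff)
  then show ?case by (simp only:) (intro assms(3) assms(2) update(3))
qed

text \<open>
The following facts describe the quotient algebra through the map \<open>cls\<close> alone: it is a surjective
ring homomorphism that kills the relators.
\<close>

lemma ideal_relation_ideal: "ideal (relation_ideal \<chi>) class_ring"
  unfolding relation_ideal_def by (rule ring.genideal_ideal[OF class_ring.ring_axioms]) simp

lemma relators_subset: "relators \<chi> \<subseteq> relation_ideal \<chi>"
  unfolding relation_ideal_def by (rule ring.genideal_self[OF class_ring.ring_axioms]) simp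

lemma cls_ring_hom: "cls \<chi> \<in> Ring.ring_hom class_ring (alg \<chi>)"
  unfolding cls_def[abs_def] alg_def by (rule ideal.rcos_ring_hom[OF ideal_relation_ideal])

lemma carrier_alg: "carrier (alg \<chi>) = range (cls \<chi>)"
proof -
  have "carrier (alg \<chi>) = a_rcosets\<^bsub>class_ring\<^esub> (relation_ideal \<chi>)"
    by (simp only: alg_def FactRing_def partial_object.select_convs)
  also have "\<dots> = range (cls \<chi>)"
    unfolding A_RCOSETS_def' cls_def[abs_def] by auto
  finally show ?thesis .
qed

lemma cls_relator:
  assumes "r \<in> relators \<chi>"
  shows "cls \<chi> r = cls \<chi> 0"
proof -
  interpret I: ideal "relation_ideal \<chi>" class_ring by (rule ideal_relation_ideal)
  have "r \<in> relation_ideal \<chi>" using assms relators_subset by blast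
  moreover have "0 \<in> relation_ideal \<chi>" using I.zero_closed by simp
  ultimately show ?thesis
    unfolding cls_def by (simp only: I.a_rcos_const)
qed

lemma star_single:
  "star (Poly_Mapping.single w a) = Poly_Mapping.single (Word (rev (letters w))) (cnj a)"
proof -
  have inj: "inj (\<lambda>w. Word (rev (letters w)))"
    by (auto intro!: injI word.expand)
  have "Poly_Mapping.map_key (\<lambda>w. Word (rev (letters w))) (Poly_Mapping.single (Word (rev (letters (Word (rev (letters w)))))) (cnj a))
      = Poly_Mapping.single (Word (rev (letters w))) (cnj a)"
    by (rule map_key_single[OF inj])
  then show ?thesis by (simp add: star_def)
qed

lemma star_add: "star (x + y) = star x + star y"
proof -
  have inj: "inj (\<lambda>w. Word (rev (letters w)))"
    by (auto intro!: injI word.expand)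
  have "Poly_Mapping.map cnj (x + y) = Poly_Mapping.map cnj x + Poly_Mapping.map cnj y"
    by (intro poly_mapping_eqI) (auto simp: lookup_add Poly_Mapping.map.rep_eq when_def simp flip: complex_cnj_add)
  then show ?thesis by (simp add: star_def map_key_plus[OF inj])
qed

lemma star_zero: "star 0 = 0"
  using star_single[of 0 0] by simp

lemma star_generator [simp]: "star (generator g) = generator g"
  by (simp add: generator_def star_single)

lemma single_Word_Cons:
  "Poly_Mapping.single (Word (g # ws)) a = generator g * Poly_Mapping.single (Word ws) a"
  by (simp add: generator_def mult_single plus_word_def)

lemma single_Word_Nil: "Poly_Mapping.single (Word []) a = scalar a"
  by (simp add: scalar_def zero_word_def)

lemma star_repD:
  assumes rep: "star_rep \<chi> n \<pi>"
  defines "\<phi> \<equiv> \<lambda>x. \<pi> (cls \<chi> x)"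
  shows "\<phi> x \<in> carrier_mat n n" "\<phi> (x + y) = \<phi> x + \<phi> y" "\<phi> (x * y) = \<phi> x * \<phi> y" "\<phi> (scalar a) = a \<cdot>\<^sub>m 1\<^sub>m n"
    "\<phi> (star x) = (\<phi> x)\<^sup>\<dagger>" "\<phi> 0 = 0\<^sub>m n n" "r \<in> relators \<chi> \<Longrightarrow> \<phi> r = 0\<^sub>m n n"
    "\<phi> (x - y) = 0\<^sub>m n n \<Longrightarrow> \<phi> x = \<phi> y"
proof -
  have "\<pi> \<in> Ring.ring_hom (alg \<chi>) (ring_mat TYPE(complex) n ())"
    using rep by (simp only: star_rep_def)
  from ring_hom_trans[OF cls_ring_hom this]
  have hom: "\<phi> \<in> Ring.ring_hom class_ring (ring_mat TYPE(complex) n ())"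
    by (simp only: \<phi>_def comp_def)
  show c: "\<phi> x \<in> carrier_mat n n" for x using ring_hom_closed[OF hom, of x] by (simp add: ring_mat_def)
  show add: "\<phi> (x + y) = \<phi> x + \<phi> y" for x y using ring_hom_add[OF hom, of x y] by (simp add: ring_mat_def)
  show "\<phi> (x * y) = \<phi> x * \<phi> y" using ring_hom_mult[OF hom, of x y] by (simp add: ring_mat_def)
  show sc: "\<phi> (scalar a) = a \<cdot>\<^sub>m 1\<^sub>m n" for a using rep by (simp add: star_rep_def \<phi>_def)
  show "\<phi> (star x) = (\<phi> x)\<^sup>\<dagger>" using rep by (simp add: star_rep_def \<phi>_def)
  have "scalar 0 = 0" by (simp add: scalar_def)
  then show zero: "\<phi> 0 = 0\<^sub>m n n" using sc[of 0] by (auto intro!: eq_matI)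
  show "\<phi> r = 0\<^sub>m n n" if "r \<in> relators \<chi>" using cls_relator[OF that] zero by (simp add: \<phi>_def)
  show "\<phi> x = \<phi> y" if "\<phi> (x - y) = 0\<^sub>m n n"
    using add[of "x - y" y] that c[of y] by simp
qed

lemma subspace_vecI:
  fixes W :: "complex vec set"
  assumes "W \<subseteq> carrier_vec n" "0\<^sub>v n \<in> W" "\<And>u v. u \<in> W \<Longrightarrow> v \<in> W \<Longrightarrow> u + v \<in> W" "\<And>c v. v \<in> W \<Longrightarrow> c \<cdot>\<^sub>v v \<in> W"
  shows "VectorSpace.subspace class_ring W (module_vec TYPE(complex) n)"
proof -
  interpret vec_space "TYPE(complex)" n .
  show ?thesis
    by (intro subspace.intro submodule.intro vectorspace_axioms module_axioms)
      (simp_all add: module_vec_simps assms)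
qed

lemma subspace_vecD:
  fixes W :: "complex vec set"
  assumes "VectorSpace.subspace class_ring W (module_vec TYPE(complex) n)"
  shows "W \<subseteq> carrier_vec n" "0\<^sub>v n \<in> W" "\<And>u v. u \<in> W \<Longrightarrow> v \<in> W \<Longrightarrow> u + v \<in> W" "\<And>c v. v \<in> W \<Longrightarrow> c \<cdot>\<^sub>v v \<in> W"
proof -
  have sub: "submodule class_ring W (module_vec TYPE(complex) n)"
    using assms by (rule subspace.submod)
  note rules = submodule.subset[OF sub] submodule.zero_closed[OF sub] submodule.m_closed[OF sub]
    submodule.smult_closed[OF sub]
  show "W \<subseteq> carrier_vec n" "0\<^sub>v n \<in> W" "\<And>u v. u \<in> W \<Longrightarrow> v \<in> W \<Longrightarrow> u + v \<in> W" "\<And>c v. v \<in> W \<Longrightarrow> c \<cdot>\<^sub>v v \<in> W"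
    using rules unfolding module_vec_simps by simp_all
qed

lemma M_f_index [simp]:
  "M_f \<chi> $ 0 = \<chi> $ 0 - \<chi> $ 1" "M_f \<chi> $ 1 = \<chi> $ 0" "M_f \<chi> $ Suc 0 = \<chi> $ 0" "M_f \<chi> $ 2 = \<chi> $ 2 - \<chi> $ 3" "M_f \<chi> $ 3 = \<chi> $ 2"
  "M_f \<chi> $ 4 = \<chi> $ 4 - \<chi> $ 5" "M_f \<chi> $ 5 = \<chi> $ 4" "M_f \<chi> $ 6 = \<chi> $ 6"
  by (simp_all add: M_f_def)

lemma generalized_dim_eq_iff:
  "generalized_dim \<chi> n \<pi> = M_d (d_vec k) \<longleftrightarrow>
     (\<forall>g. real (vec_space.rank n (gen_image \<chi> \<pi> g)) = rank_at (dim_at k) g) \<and> real n = dim_at k $ 6"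
proof -
  have dim: "dim_vec (d_vec k) = 7" by (simp add: d_vec_def)
  have int_iff: "int m = a - b \<longleftrightarrow> real m = real_of_int a - real_of_int b"
    "int m = a \<longleftrightarrow> real m = real_of_int a" for m a b
    by (metis of_int_diff of_int_eq_iff of_int_of_nat_eq)+
  have "generalized_dim \<chi> n \<pi> = M_d (d_vec k) \<longleftrightarrow> (\<forall>i\<in>{0,1,2,3,4,5,6}. generalized_dim \<chi> n \<pi> $ i = M_d (d_vec k) $ i)"
  proof
    assume "\<forall>i\<in>{0,1,2,3,4,5,6}. generalized_dim \<chi> n \<pi> $ i = M_d (d_vec k) $ i"
    then show "generalized_dim \<chi> n \<pi> = M_d (d_vec k)"
      by (intro vec_7_eqI) (simp_all add: generalized_dim_def M_d_def)
  qed simp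
  then show ?thesis
    by (simp add: generalized_dim_def M_d_def dim_at_def dim all_gen int_iff conj_ac)
qed

lemma relators_mem:
  "generator g * generator g - generator g \<in> relators \<chi>"
  "generator g * generator (partner g) \<in> relators \<chi>"
  "scalar (of_real (\<chi> $ 0)) * generator P1 + scalar (of_real (\<chi> $ 1)) * generator P2
      + scalar (of_real (\<chi> $ 2)) * generator Q1 + scalar (of_real (\<chi> $ 3)) * generator Q2
      + scalar (of_real (\<chi> $ 4)) * generator S1 + scalar (of_real (\<chi> $ 5)) * generator S2
      - scalar (of_real (\<chi> $ 6)) \<in> relators \<chi>"
proof -
  show "generator g * generator g - generator g \<in> relators \<chi>" by (auto simp: relators_def)
  show "generator g * generator (partner g) \<in> relators \<chi>" by (cases g) (simp_all add: relators_def)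
qed (simp add: relators_def)

lemma gsum_eq_add:
  assumes "\<And>g. F g \<in> carrier_mat n m"
  shows "gsum n m F = F P1 + F P2 + F Q1 + F Q2 + F S1 + F S2"
proof -
  have "dim_row (F g) = n" "dim_col (F g) = m" for g using carrier_matD[OF assms[of g]] by simp_all
  then show ?thesis by (intro eq_matI) (simp_all add: sum_gen)
qed

lemma projection_system_star_rep:
  assumes rep: "star_rep \<chi> n \<pi>"
  shows "projection_system (weight (M_f \<chi>)) (M_f \<chi> $ 6) n (gen_image \<chi> \<pi>)"
proof -
  note \<phi> = star_repD[OF rep]
  note [simp] = \<phi>(1)
  have herm: "hermitian_idempotent n (gen_image \<chi> \<pi> g)" for g
    using \<phi>(8)[OF \<phi>(7)[OF relators_mem(1)[of g \<chi>]]] \<phi>(5)[of "generator g"] \<phi>(3)[of "generator g" "generator g"]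
    by (simp add: hermitian_idempotent_def gen_image_def)
  have orth: "gen_image \<chi> \<pi> g * gen_image \<chi> \<pi> (partner g) = 0\<^sub>m n n" for g
    using \<phi>(7)[OF relators_mem(2)[of g \<chi>]] \<phi>(3)[of "generator g" "generator (partner g)"]
    by (simp add: gen_image_def)
  have scale: "(c \<cdot>\<^sub>m 1\<^sub>m n) * \<pi> (cls \<chi> x) = c \<cdot>\<^sub>m \<pi> (cls \<chi> x)" for c x
    by (rule smult_one_mult[of _ n n]) simp
  have "gsum n n (\<lambda>g. of_real (weight (M_f \<chi>) g) \<cdot>\<^sub>m gen_image \<chi> \<pi> g) = of_real (\<chi> $ 6) \<cdot>\<^sub>m 1\<^sub>m n"
    using \<phi>(8)[OF \<phi>(7)[OF relators_mem(3)[of \<chi>]]]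
    by (subst gsum_eq_add) (simp_all add: gen_image_def \<phi>(2,3,4) scale)
  then show ?thesis
    unfolding projection_system_def by (intro conjI allI herm orth) simp
qed

text \<open>
The images of the generators generate the image of the representation as a unital algebra.
\<close>

lemma commutes_with_star_rep:
  assumes rep: "star_rep \<chi> n \<pi>" and X: "X \<in> carrier_mat n n" "\<And>g. X * gen_image \<chi> \<pi> g = gen_image \<chi> \<pi> g * X"
  shows "X * \<pi> (cls \<chi> x) = \<pi> (cls \<chi> x) * X"
proof (induction x rule: free_alg_induct)
  case zero
  then show ?case using X(1) by (simp add: star_repD(6)[OF rep])
next
  case (single w a)
  have "X * \<pi> (cls \<chi> (Poly_Mapping.single (Word ws) a)) = \<pi> (cls \<chi> (Poly_Mapping.single (Word ws) a)) * X" for ws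
  proof (induction ws)
    case Nil
    show ?case using smult_one_mult[OF X(1), of a] by (simp only: single_Word_Nil star_repD(4)[OF rep])
  next
    case (Cons g ws)
    note dims = star_repD(1)[OF rep] X(1)
    have "X * (\<pi> (cls \<chi> (generator g)) * \<pi> (cls \<chi> (Poly_Mapping.single (Word ws) a))) =
        (X * \<pi> (cls \<chi> (generator g))) * \<pi> (cls \<chi> (Poly_Mapping.single (Word ws) a))"
      by (rule assoc_mult_mat[symmetric]) (rule dims)+
    also have "\<dots> = \<pi> (cls \<chi> (generator g)) * (X * \<pi> (cls \<chi> (Poly_Mapping.single (Word ws) a)))"
      unfolding X(2)[unfolded gen_image_def] by (rule assoc_mult_mat) (rule dims)+
    also have "\<dots> = (\<pi> (cls \<chi> (generator g)) * \<pi> (cls \<chi> (Poly_Mapping.single (Word ws) a))) * X"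
      unfolding Cons by (rule assoc_mult_mat[symmetric]) (rule dims)+
    finally show ?case by (simp only: single_Word_Cons star_repD(3)[OF rep])
  qed
  from this[of "letters w"] show ?case by simp
next
  case (add x y)
  have "X * (\<pi> (cls \<chi> x) + \<pi> (cls \<chi> y)) = X * \<pi> (cls \<chi> x) + X * \<pi> (cls \<chi> y)"
    by (rule mult_add_distrib_mat) (rule star_repD(1)[OF rep] X(1))+
  also have "\<dots> = (\<pi> (cls \<chi> x) + \<pi> (cls \<chi> y)) * X"
    unfolding add by (rule add_mult_distrib_mat[symmetric]) (rule star_repD(1)[OF rep] X(1))+
  finally show ?case by (simp only: star_repD(2)[OF rep])
qed

text \<open>
Schur's lemma: an eigenspace of an operator in the commutant is invariant, hence everything.
\<close>

lemma trivial_commutant_of_irreducible: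
  assumes rep: "star_rep \<chi> n \<pi>" and irr: "irreducible_rep \<chi> n \<pi>"
  shows "trivial_commutant n (gen_image \<chi> \<pi>)"
  unfolding trivial_commutant_def
proof (intro ballI impI)
  fix X :: "complex mat" assume Xc: "X \<in> carrier_mat n n" and X: "\<forall>g. X * gen_image \<chi> \<pi> g = gen_image \<chi> \<pi> g * X"
  have n: "0 < n" using irr by (simp add: irreducible_rep_def)
  obtain z where "eigenvalue X z" using spectrum_non_empty[OF Xc n] by (auto simp: spectrum_def)
  then obtain v where v: "v \<in> carrier_vec n" "v \<noteq> 0\<^sub>v n" "X *\<^sub>v v = z \<cdot>\<^sub>v v"
    using Xc by (auto simp: eigenvalue_def eigenvector_def)
  define W where "W = {v \<in> carrier_vec n. X *\<^sub>v v = z \<cdot>\<^sub>v v}"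
  have "VectorSpace.subspace class_ring W (module_vec TYPE(complex) n)"
  proof (rule subspace_vecI)
    show "u + v \<in> W" if "u \<in> W" "v \<in> W" for u v
      using that by (auto simp: W_def mult_add_distrib_mat_vec[OF Xc] smult_add_distrib_vec[of _ n])
    show "c \<cdot>\<^sub>v v \<in> W" if "v \<in> W" for c v
      using that by (simp add: W_def mult_mat_vec[OF Xc] smult_smult_assoc mult.commute)
    show "0\<^sub>v n \<in> W" using Xc by (auto simp: W_def scalar_prod_def intro!: eq_vecI)
  qed (simp add: W_def)
  moreover have "\<pi> C *\<^sub>v w \<in> W" if Ccarr: "C \<in> carrier (alg \<chi>)" and wW: "w \<in> W" for C w
  proof -
    obtain x where C: "C = cls \<chi> x" using Ccarr unfolding carrier_alg by blast
    note c = star_repD(1)[OF rep, of x]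
    have w: "w \<in> carrier_vec n" "X *\<^sub>v w = z \<cdot>\<^sub>v w" using wW by (simp_all add: W_def)
    have "X *\<^sub>v (\<pi> C *\<^sub>v w) = (X * \<pi> C) *\<^sub>v w"
      unfolding C by (rule assoc_mult_mat_vec[OF Xc c w(1), symmetric])
    also have "\<dots> = (\<pi> C * X) *\<^sub>v w"
      unfolding C commutes_with_star_rep[OF rep Xc X[rule_format]] ..
    also have "\<dots> = \<pi> C *\<^sub>v (z \<cdot>\<^sub>v w)"
      unfolding C w(2)[symmetric] by (rule assoc_mult_mat_vec[OF c Xc w(1)])
    also have "\<dots> = z \<cdot>\<^sub>v (\<pi> C *\<^sub>v w)"
      unfolding C by (rule mult_mat_vec[OF c w(1)])
    finally show ?thesis using c w(1) by (simp add: W_def C)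
  qed
  ultimately have "W = {0\<^sub>v n} \<or> W = carrier_vec n"
    using irr unfolding irreducible_rep_def by blast
  moreover have "v \<in> W" using v by (simp add: W_def)
  ultimately have W: "W = carrier_vec n" using v(2) by blast
  have "X = z \<cdot>\<^sub>m 1\<^sub>m n"
  proof (rule mat_eqI_mult_vec[OF Xc])
    fix u :: "complex vec" assume u: "u \<in> carrier_vec n"
    then have "X *\<^sub>v u = z \<cdot>\<^sub>v u" using W by (auto simp: W_def)
    also have "\<dots> = (z \<cdot>\<^sub>m 1\<^sub>m n) *\<^sub>v u" using u by (intro eq_vecI) auto
    finally show "X *\<^sub>v u = (z \<cdot>\<^sub>m 1\<^sub>m n) *\<^sub>v u" .
  qed simp
  then show "\<exists>z. X = z \<cdot>\<^sub>m 1\<^sub>m n" ..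
qed

theorem realizable_of_star_rep:
  assumes rep: "star_rep \<chi> n \<pi>" and irr: "irreducible_rep \<chi> n \<pi>"
    and dim: "generalized_dim \<chi> n \<pi> = M_d (d_vec k)"
  shows "realizable (M_f \<chi>) (dim_at k)"
proof -
  note sys = projection_system_star_rep[OF rep]
  have "tr (gen_image \<chi> \<pi> g) = of_real (rank_at (dim_at k) g)" for g
    using rank_hermitian_idempotent[OF projection_systemD(8)[OF sys, of g]] dim
    unfolding generalized_dim_eq_iff by (metis of_real_of_nat_eq)
  then show ?thesis
    unfolding realizable_def
    using sys trivial_commutant_of_irreducible[OF rep irr] dim unfolding generalized_dim_eq_iff by blast
qed

fun word_mat :: "nat \<Rightarrow> (gen \<Rightarrow> complex mat) \<Rightarrow> gen list \<Rightarrow> complex mat" where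
  "word_mat n P [] = 1\<^sub>m n"
| "word_mat n P (g # ws) = P g * word_mat n P ws"

text \<open>
Substitution of the matrices \<open>P g\<close> for the generators in an element of the free algebra.
\<close>

definition ev :: "nat \<Rightarrow> (gen \<Rightarrow> complex mat) \<Rightarrow> free_alg \<Rightarrow> complex mat" where
  "ev n P x = mat n n (\<lambda>(i, j). \<Sum>w\<in>Poly_Mapping.keys x. Poly_Mapping.lookup x w * word_mat n P (letters w) $$ (i, j))"

lemma ev_dim [simp]: "dim_row (ev n P x) = n" "dim_col (ev n P x) = n"
  by (simp_all add: ev_def)

lemma ev_carrier [simp]: "ev n P x \<in> carrier_mat n n"
  by (simp add: ev_def)

lemma ev_index:
  assumes "finite A" "Poly_Mapping.keys x \<subseteq> A" "i < n" "j < n"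
  shows "ev n P x $$ (i, j) = (\<Sum>w\<in>A. Poly_Mapping.lookup x w * word_mat n P (letters w) $$ (i, j))"
  unfolding ev_def using assms by (simp, intro sum.mono_neutral_left) (auto simp: in_keys_iff)

lemma ev_zero [simp]: "ev n P 0 = 0\<^sub>m n n"
  by (rule eq_matI) (simp_all add: ev_def)

lemma ev_add: "ev n P (x + y) = ev n P x + ev n P y"
proof (rule eq_matI)
  fix i j assume "i < dim_row (ev n P x + ev n P y)" "j < dim_col (ev n P x + ev n P y)"
  then have ij: "i < n" "j < n" by simp_all
  let ?A = "Poly_Mapping.keys x \<union> Poly_Mapping.keys y"
  have "ev n P z $$ (i, j) = (\<Sum>w\<in>?A. Poly_Mapping.lookup z w * word_mat n P (letters w) $$ (i, j))"
    if "Poly_Mapping.keys z \<subseteq> ?A" for z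
    using that ij by (intro ev_index) simp_all
  note this[of x] this[of y] this[of "x + y"]
  then show "ev n P (x + y) $$ (i, j) = (ev n P x + ev n P y) $$ (i, j)"
    using ij Poly_Mapping.keys_add[of x y] by (simp add: lookup_add sum.distrib distrib_right)
qed simp_all

lemma ev_minus: "ev n P (x - y) = ev n P x - ev n P y"
  using ev_add[of n P "x - y" y] by (intro eq_matI) simp_all

context
  fixes n :: nat and P :: "gen \<Rightarrow> complex mat"
  assumes P: "\<And>g. P g \<in> carrier_mat n n"
begin

lemma word_mat_carrier: "word_mat n P ws \<in> carrier_mat n n"
proof (induction ws)
  case (Cons g ws)
  then show ?case using mult_carrier_mat[OF P Cons] by simp
qed simp

lemma word_mat_dim [simp]: "dim_row (word_mat n P ws) = n" "dim_col (word_mat n P ws) = n"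
  using carrier_matD[OF word_mat_carrier] by simp_all

lemma word_mat_append: "word_mat n P (us @ vs) = word_mat n P us * word_mat n P vs"
proof (induction us)
  case Nil
  show ?case using word_mat_carrier[of vs] by simp
next
  case (Cons g us)
  then show ?case using assoc_mult_mat[OF P word_mat_carrier word_mat_carrier, of g us vs] by simp
qed

lemma ev_single: "ev n P (Poly_Mapping.single w a) = a \<cdot>\<^sub>m word_mat n P (letters w)"
proof (rule eq_matI)
  fix i j assume "i < dim_row (a \<cdot>\<^sub>m word_mat n P (letters w))" "j < dim_col (a \<cdot>\<^sub>m word_mat n P (letters w))"
  then show "ev n P (Poly_Mapping.single w a) $$ (i, j) = (a \<cdot>\<^sub>m word_mat n P (letters w)) $$ (i, j)"
    by (subst ev_index[of "{w}"]) (auto simp: lookup_single)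
qed simp_all

lemma ev_scalar: "ev n P (scalar a) = a \<cdot>\<^sub>m 1\<^sub>m n"
  by (simp add: scalar_def ev_single zero_word_def)

lemma ev_generator: "ev n P (generator g) = P g"
  using P[of g] by (simp add: generator_def ev_single)

lemma ev_mult: "ev n P (x * y) = ev n P x * ev n P y"
proof (induction x rule: free_alg_induct)
  case zero
  show ?case using left_mult_zero_mat[OF ev_carrier[of n P y], of n] by simp
next
  case (add x x')
  show ?case
    unfolding distrib_right ev_add add by (rule mat_add_mult[symmetric]) simp_all
next
  case (single u a)
  show ?case
  proof (induction y rule: free_alg_induct)
    case zero
    show ?case using right_mult_zero_mat[OF ev_carrier[of n P "Poly_Mapping.single u a"], of n] by simp
  next
    case (add y y')
    show ?case
      unfolding distrib_left ev_add add by (rule mat_mult_add[symmetric]) simp_all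
  next
    case (single v b)
    show ?case
      by (simp add: mult_single ev_single plus_word_def word_mat_append mat_smult_mult mat_mult_smult smult_smult_mat
          mult.commute)
  qed
qed

lemma ev_star:
  assumes adj: "\<And>g. (P g)\<^sup>\<dagger> = P g"
  shows "ev n P (star x) = (ev n P x)\<^sup>\<dagger>"
proof (induction x rule: free_alg_induct)
  case (single w a)
  have "word_mat n P (rev ws) = (word_mat n P ws)\<^sup>\<dagger>" for ws
  proof (induction ws)
    case (Cons g ws)
    then show ?case
      using P[of g] adjoint_mult[of "P g" "word_mat n P ws"] by (simp add: word_mat_append adj)
  qed simp
  then show ?case by (simp add: star_single ev_single adjoint_smult)
next
  case (add x y)
  then show ?case by (simp add: star_add ev_add adjoint_add)
qed (simp add: star_zero)

lemma ev_ring_hom: "ev n P \<in> Ring.ring_hom class_ring (ring_mat TYPE(complex) n ())"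
proof -
  have one: "ev n P 1 = 1\<^sub>m n" using ev_scalar[of 1] by (simp add: scalar_def)
  show ?thesis
    by (intro ring_hom_memI) (simp_all add: ring_mat_def ev_mult ev_add one)
qed

end

lemma pair_relators:
  "{generator P1 * generator P2, generator P2 * generator P1,
    generator Q1 * generator Q2, generator Q2 * generator Q1,
    generator S1 * generator S2, generator S2 * generator S1} =
   range (\<lambda>g. generator g * generator (partner g))"
  by (simp add: UNIV_gen)

text \<open>
The kernel of the substitution is an ideal that contains the relators, so the substitution is constant on
the cosets of the relation ideal and may be computed on any representative.
\<close>

theorem star_rep_of_projection_system:
  assumes sys: "projection_system (weight (M_f \<chi>)) (\<chi> $ 6) n P"
  obtains \<pi> where "star_rep \<chi> n \<pi>" "\<And>x. \<pi> (cls \<chi> x) = ev n P x"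
proof -
  note P = projection_systemD[OF sys]
  note ev = ev_ring_hom[OF P(1)] ev_mult[OF P(1)] ev_scalar[OF P(1)] ev_generator[OF P(1)]
  define K where "K = {x. ev n P x = 0\<^sub>m n n}"
  have "ring_hom_ring class_ring (ring_mat TYPE(complex) n ()) (ev n P)"
    by (rule ring_hom_ringI2[OF class_ring.ring_axioms ring_mat ev(1)])
  from ring_hom_ring.kernel_is_ideal[OF this]
  have "ideal K class_ring"
    by (simp add: a_kernel_def' K_def ring_mat_def)
  moreover have "relators \<chi> \<subseteq> K"
  proof
    fix r assume "r \<in> relators \<chi>"
    then consider g where "r = generator g * generator g - generator g"
      | g where "r = generator g * generator (partner g)"
      | "r = scalar (of_real (\<chi> $ 0)) * generator P1 + scalar (of_real (\<chi> $ 1)) * generator P2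
      + scalar (of_real (\<chi> $ 2)) * generator Q1 + scalar (of_real (\<chi> $ 3)) * generator Q2
      + scalar (of_real (\<chi> $ 4)) * generator S1 + scalar (of_real (\<chi> $ 5)) * generator S2
      - scalar (of_real (\<chi> $ 6))"
      unfolding relators_def pair_relators by blast
    then show "r \<in> K"
    proof cases
      case 1
      have "P g - P g = 0\<^sub>m n n" for g by (rule eq_matI) (simp_all add: P(2,3))
      then show ?thesis by (simp add: 1 K_def ev_minus ev(2,4) P(5))
    next
      case 2
      then show ?thesis by (simp add: K_def ev(2,4) P(6))
    next
      case 3
      have "gsum n n (\<lambda>g. of_real (weight (M_f \<chi>) g) \<cdot>\<^sub>m P g) - of_real (\<chi> $ 6) \<cdot>\<^sub>m 1\<^sub>m n = 0\<^sub>m n n"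
        unfolding P(7) by (rule eq_matI) simp_all
      then show ?thesis
        by (simp add: 3 K_def ev_minus ev_add ev(2,3,4) gsum_eq_add P(1) smult_one_mult(1)[OF P(1)])
    qed
  qed
  ultimately have ideal: "relation_ideal \<chi> \<subseteq> K"
    unfolding relation_ideal_def by (rule ring.genideal_minimal[OF class_ring.ring_axioms])
  define \<pi> where "\<pi> C = ev n P (SOME x. cls \<chi> x = C)" for C
  have \<pi>: "\<pi> (cls \<chi> x) = ev n P x" for x
  proof -
    interpret I: ideal "relation_ideal \<chi>" class_ring by (rule ideal_relation_ideal)
    define y where "y = (SOME y. cls \<chi> y = cls \<chi> x)"
    have "cls \<chi> y = cls \<chi> x" unfolding y_def by (rule someI[of _ x]) (rule refl)
    moreover have "y \<in> cls \<chi> y" unfolding cls_def by (rule I.a_rcos_self) simp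
    ultimately have "y \<in> cls \<chi> x" by simp
    then obtain i where i: "i \<in> relation_ideal \<chi>" "y = i + x"
      unfolding cls_def a_r_coset_def' by auto
    then have "ev n P y = ev n P x"
      using ideal by (auto simp: K_def ev_add)
    then show ?thesis by (simp add: \<pi>_def y_def)
  qed
  have "\<pi> \<in> Ring.ring_hom (alg \<chi>) (ring_mat TYPE(complex) n ())"
  proof (rule ring_hom_memI)
    show "\<pi> C \<in> carrier (ring_mat TYPE(complex) n ())" if "C \<in> carrier (alg \<chi>)" for C
      by (simp add: \<pi>_def ring_mat_def)
    fix C C' assume "C \<in> carrier (alg \<chi>)" "C' \<in> carrier (alg \<chi>)"
    then obtain x y where xy: "C = cls \<chi> x" "C' = cls \<chi> y" unfolding carrier_alg by blast
    have "C \<otimes>\<^bsub>alg \<chi>\<^esub> C' = cls \<chi> (x * y)" "C \<oplus>\<^bsub>alg \<chi>\<^esub> C' = cls \<chi> (x + y)"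
      using ring_hom_mult[OF cls_ring_hom, of x y \<chi>] ring_hom_add[OF cls_ring_hom, of x y \<chi>] by (simp_all add: xy)
    then show "\<pi> (C \<otimes>\<^bsub>alg \<chi>\<^esub> C') = \<pi> C \<otimes>\<^bsub>ring_mat TYPE(complex) n ()\<^esub> \<pi> C'"
      "\<pi> (C \<oplus>\<^bsub>alg \<chi>\<^esub> C') = \<pi> C \<oplus>\<^bsub>ring_mat TYPE(complex) n ()\<^esub> \<pi> C'"
      by (simp_all add: xy \<pi> ev(2) ev_add ring_mat_def)
  next
    have "\<one>\<^bsub>alg \<chi>\<^esub> = cls \<chi> 1"
      using ring_hom_one[OF cls_ring_hom, of \<chi>] by simp
    moreover have "ev n P 1 = 1\<^sub>m n" using ev_scalar[OF P(1), where a = 1] by (simp add: scalar_def)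
    ultimately show "\<pi> \<one>\<^bsub>alg \<chi>\<^esub> = \<one>\<^bsub>ring_mat TYPE(complex) n ()\<^esub>"
      by (simp add: \<pi> ring_mat_def)
  qed
  then have "star_rep \<chi> n \<pi>"
    unfolding star_rep_def by (simp add: \<pi> ev(3) ev_star[OF P(1,4)])
  then show thesis using that \<pi> by blast
qed

text \<open>
The orthogonal projection \<open>Q\<close> onto an invariant subspace satisfies \<open>Q P g Q = P g Q\<close>. The adjoint of
this equation shows that \<open>Q\<close> commutes with the Hermitian \<open>P g\<close>, so \<open>Q\<close> is \<open>0\<close> or \<open>1\<close>.
\<close>

lemma irreducible_of_trivial_commutant:
  assumes rep: "star_rep \<chi> n \<pi>" and n: "0 < n"
    and triv: "trivial_commutant n (gen_image \<chi> \<pi>)"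
  shows "irreducible_rep \<chi> n \<pi>"
  unfolding irreducible_rep_def
proof (intro conjI allI impI n)
  fix W assume sub: "VectorSpace.subspace class_ring W (module_vec TYPE(complex) n)"
    and inv: "\<forall>C\<in>carrier (alg \<chi>). \<forall>w\<in>W. \<pi> C *\<^sub>v w \<in> W"
  note P = projection_systemD[OF projection_system_star_rep[OF rep]]
  obtain m V where V: "V \<in> carrier_mat m n" "V * V\<^sup>\<dagger> = 1\<^sub>m m"
    and W: "W = {v \<in> carrier_vec n. (V\<^sup>\<dagger> * V) *\<^sub>v v = v}"
    by (rule subspace_coisometry[of W n]) (use subspace_vecD[OF sub] in blast)+
  note [simp] = carrier_matD[OF V(1)]
  define Q where "Q = V\<^sup>\<dagger> * V"
  have Qc: "Q \<in> carrier_mat n n" unfolding Q_def by (intro carrier_matI) simp_all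
  have "V\<^sup>\<dagger> * V * (V\<^sup>\<dagger> * V) = V\<^sup>\<dagger> * ((V * V\<^sup>\<dagger>) * V)" by (simp add: mat_mult_assoc)
  then have QQ: "Q * Q = Q" unfolding V(2) Q_def using V(1) by simp
  have Qadj: "Q\<^sup>\<dagger> = Q" by (simp add: Q_def adjoint_mult)
  have QPQ: "Q * (gen_image \<chi> \<pi> g * Q) = gen_image \<chi> \<pi> g * Q" for g
  proof (rule mat_eqI_mult_vec[of _ n n])
    fix v :: "complex vec" assume v: "v \<in> carrier_vec n"
    have Qv: "Q *\<^sub>v v \<in> carrier_vec n" using Qc v by simp
    have "Q *\<^sub>v (Q *\<^sub>v v) = Q *\<^sub>v v"
      using assoc_mult_mat_vec[OF Qc Qc v] QQ by simp
    then have "Q *\<^sub>v v \<in> W" using Qv unfolding W Q_def[symmetric] by simp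
    then have "gen_image \<chi> \<pi> g *\<^sub>v (Q *\<^sub>v v) \<in> W"
      using inv unfolding gen_image_def carrier_alg by blast
    then have "Q *\<^sub>v (gen_image \<chi> \<pi> g *\<^sub>v (Q *\<^sub>v v)) = gen_image \<chi> \<pi> g *\<^sub>v (Q *\<^sub>v v)"
      unfolding W Q_def[symmetric] by simp
    then show "(Q * (gen_image \<chi> \<pi> g * Q)) *\<^sub>v v = (gen_image \<chi> \<pi> g * Q) *\<^sub>v v"
      using assoc_mult_mat_vec[OF Qc mult_carrier_mat[OF P(1) Qc] v, of g] assoc_mult_mat_vec[OF P(1) Qc v, of g]
      by simp
  qed (use mult_carrier_mat[OF P(1)[of g] Qc] mult_carrier_mat[OF Qc mult_carrier_mat[OF P(1)[of g] Qc]] in simp_all)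
  have dimQ [simp]: "dim_row Q = n" "dim_col Q = n" using carrier_matD[OF Qc] by simp_all
  have "Q * gen_image \<chi> \<pi> g = gen_image \<chi> \<pi> g * Q" for g
  proof -
    have "(Q * (gen_image \<chi> \<pi> g * Q))\<^sup>\<dagger> = (gen_image \<chi> \<pi> g * Q)\<^sup>\<dagger>" by (simp only: QPQ)
    then have "Q * (gen_image \<chi> \<pi> g * Q) = Q * gen_image \<chi> \<pi> g"
      by (simp add: adjoint_mult P(2-4) Qadj mat_mult_assoc)
    then show ?thesis by (simp only: QPQ)
  qed
  then obtain z where z: "Q = z \<cdot>\<^sub>m 1\<^sub>m n"
    using triv[unfolded trivial_commutant_def, rule_format, OF Qc] by blast
  have "z * z = z"
    using arg_cong[OF QQ, of "\<lambda>A. A $$ (0, 0)"] n unfolding z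
    by (simp add: mat_smult_mult mat_mult_smult)
  then consider "z = 0" | "z = 1" by auto
  then show "W = {0\<^sub>v n} \<or> W = carrier_vec n"
  proof cases
    case 1
    have "Q *\<^sub>v v = 0\<^sub>v n" if "v \<in> carrier_vec n" for v
      unfolding z 1 using that by (intro eq_vecI) (auto simp: scalar_prod_def)
    then have "W = {0\<^sub>v n}" unfolding W Q_def[symmetric] by auto
    then show ?thesis ..
  next
    case 2
    have "Q *\<^sub>v v = v" if "v \<in> carrier_vec n" for v
      unfolding z 2 using that by simp
    then have "W = carrier_vec n" unfolding W Q_def[symmetric] by auto
    then show ?thesis ..
  qed
qed

theorem star_rep_of_realizable:
  assumes real: "realizable (M_f \<chi>) (dim_at k)" and k: "8 \<le> k"
  shows "\<exists>n \<pi>. star_rep \<chi> n \<pi> \<and> irreducible_rep \<chi> n \<pi> \<and> nondegenerate_rep \<chi> n \<pi> \<and>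
    generalized_dim \<chi> n \<pi> = M_d (d_vec k)"
proof -
  obtain n P where n: "real n = dim_at k $ 6" and sys: "projection_system (weight (M_f \<chi>)) (\<chi> $ 6) n P"
    and triv: "trivial_commutant n P" and tr: "\<And>g. tr (P g) = of_real (rank_at (dim_at k) g)"
    using real unfolding realizable_def M_f_index by blast
  note P = projection_systemD[OF sys]
  obtain \<pi> where rep: "star_rep \<chi> n \<pi>" and \<pi>: "\<And>x. \<pi> (cls \<chi> x) = ev n P x"
    using star_rep_of_projection_system[OF sys] by blast
  have gen: "gen_image \<chi> \<pi> = P"
    by (rule ext) (simp add: gen_image_def \<pi> ev_generator[OF P(1)])
  have pos: "0 < rank_at (dim_at k) g" for g using rank_at_dim_at_pos[of k g] k by simp
  have less: "rank_at (dim_at k) g + rank_at (dim_at k) (partner g) < real n" for g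
    unfolding n by (rule rank_at_less_dim_at[OF k])
  have "0 < n" using less[of P1] pos[of P1] pos[of P2] by simp
  then have "irreducible_rep \<chi> n \<pi>"
    by (rule irreducible_of_trivial_commutant[OF rep]) (simp only: gen triv)
  moreover have "nondegenerate_rep \<chi> n \<pi>"
  proof -
    have "P g \<noteq> 0\<^sub>m n n" for g
      using tr[of g] pos[of g] by auto
    moreover have "P g + P (partner g) \<noteq> 1\<^sub>m n" for g
    proof
      assume "P g + P (partner g) = 1\<^sub>m n"
      then have "tr (P g + P (partner g)) = of_nat n" by simp
      then have "complex_of_real (rank_at (dim_at k) g + rank_at (dim_at k) (partner g)) = of_real (real n)"
        by (simp add: tr_add P(2,3) tr)
      then show False using less[of g] unfolding of_real_eq_iff by simp
    qed
    note this[of P1] this[of Q1] this[of S1]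
    ultimately show ?thesis by (simp add: nondegenerate_rep_def gen)
  qed
  moreover have "real (vec_space.rank n (P g)) = rank_at (dim_at k) g" for g
  proof -
    have "complex_of_real (real (vec_space.rank n (P g))) = of_real (rank_at (dim_at k) g)"
      using rank_hermitian_idempotent[OF P(8), of g] tr[of g] by simp
    then show ?thesis by (simp only: of_real_eq_iff)
  qed
  then have "generalized_dim \<chi> n \<pi> = M_d (d_vec k)"
    unfolding generalized_dim_eq_iff gen using n by blast
  ultimately show ?thesis using rep by blast
qed

theorem theorem4:
  fixes \<alpha>1 \<alpha>2 \<beta>1 \<beta>2 \<delta>1 \<delta>2 \<gamma> :: real and \<chi> :: "real vec" and k :: nat
  assumes "\<chi> = vec_of_list [\<alpha>1, \<alpha>2, \<beta>1, \<beta>2, \<delta>1, \<delta>2, \<gamma>]"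
    and "\<alpha>1 > \<alpha>2" and "\<alpha>2 > 0"
    and "\<beta>1 > \<beta>2" and "\<beta>2 > 0"
    and "\<delta>1 > \<delta>2" and "\<delta>2 > 0"
    and "k \<ge> 8"
  shows "(\<exists>n \<pi>. star_rep \<chi> n \<pi> \<and> irreducible_rep \<chi> n \<pi> \<and> nondegenerate_rep \<chi> n \<pi> \<and>
            generalized_dim \<chi> n \<pi> = M_d (d_vec k)) \<longleftrightarrow>
         (\<forall>i<6. D_map k \<chi> $ i > 0) \<and> D_map k \<chi> $ 6 = 0"
proof -
  have "decreasing_weights (M_f \<chi>)"
    using assms(2-7) by (simp add: decreasing_weights_def assms(1))
  with \<open>k \<ge> 8\<close> have "realizable (M_f \<chi>) (dim_at k) \<longleftrightarrow> (\<forall>i<6. D_map k \<chi> $ i > 0) \<and> D_map k \<chi> $ 6 = 0"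
    by (rule realizable_iff_D_map)
  moreover have "(\<exists>n \<pi>. star_rep \<chi> n \<pi> \<and> irreducible_rep \<chi> n \<pi> \<and> nondegenerate_rep \<chi> n \<pi> \<and>
      generalized_dim \<chi> n \<pi> = M_d (d_vec k)) \<longleftrightarrow> realizable (M_f \<chi>) (dim_at k)"
    using realizable_of_star_rep star_rep_of_realizable[OF _ \<open>k \<ge> 8\<close>] by blast
  ultimately show ?thesis by (simp only:)
qed

end
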